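(* Let $x_1,\dots,x_N\in\mathbb{R}$ and let $t_1,\dots,t_k\in\mathbb{R}$ be knots. Let $X$ be the $N\times k$ matrix of standardized piecewise constant basis functions, i.e. the $j$-th column of $X$ is obtained from the vector $(I(x_i>t_j))_{i=1}^N$ by centering it to mean zero and scaling it to unit Euclidean norm. Assume that the columns of $X$ are well defined and linearly independent. Then for every non-empty subset $A\subseteq\{1,\dots,k\}$ and every diagonal matrix $S_A=\mathrm{diag}(s_j)_{j\in A}$ with $s_j\in\{-1,1\}$, $$S_A\,(X_A^TX_A)^{-1}\,S_A\,\mathbf 1\ \ge\ 0\quad\text{(componentwise)},$$ where $X_A$ is the submatrix of columns of $X$ with index in $A$ and $\mathbf 1$ is the vector of ones. Hence, for every centered response $\mathbf y\in\mathbb{R}^N$, the coefficient paths of the lasso, of infinitesimal forward stagewise regression ($\mathrm{FS}_0$) and of least angle regression (LAR) for the predictors $X$ coincide.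
   Context: All three paths are curves in $\mathbb{R}^k$ of coefficient vectors $\beta$ for the linear model $\mathbf y\approx X\beta$ with standardized predictors $\mathbf x_1,\dots,\mathbf x_k$ (columns of $X$), starting at $\beta=0$ and ending at the full least squares solution. Lasso path: the curve $s\mapsto\beta(s)$, where $\beta(s)$ minimizes $\|\mathbf y-X\beta\|_2^2$ subject to $\sum_j|\beta_j|\le s$. LAR path: start at $\beta=0$, with residual $\mathbf r=\mathbf y$ and active set $A$ the set of indices $j$ maximizing $|\mathbf x_j^T\mathbf r|$. Move the coefficients $\beta_A$ in the direction of the least squares coefficient of the current residual $\mathbf r$ on $X_A$ (other coefficients unchanged) until some variable outside $A$ has as large an absolute inner product with the current residual $\mathbf r=\mathbf y-X\beta$ as the variables in $A$; add it to $A$, recompute the direction, and continue until the full least squares solution is reached. $\mathrm{FS}_0$ path: the limit as $\epsilon\downarrow0$ of the procedure that repeatedly finds the predictor $\mathbf x_j$ most correlated in absolute value with the current residual $\mathbf r$, and updates $\beta_j\leftarrow\beta_j+\delta_j$, $\mathbf r\leftarrow\mathbf r-\delta_j\mathbf x_j$ with $\delta_j=\epsilon\,\mathrm{sign}(\mathbf x_j^T\mathbf r)$. Equivalently, it is the path obtained as in LAR, with $A$ the set of indices maximizing $|\mathbf x_j^T\mathbf r|$, but with each direction given by the solution of the constrained problem $\min_b\|\mathbf r-X_Ab\|_2^2$ subject to $b_js_j\ge0$ for $j\in A$, where $s_j=\mathrm{sign}(\mathbf x_j^T\mathbf r)$. *)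

theory Defs
  imports "HOL-Analysis.Analysis"
begin

section \<open>Standardized piecewise constant basis\<close>

definition center :: "real ^ 'n \<Rightarrow> real ^ 'n" where
  "center v = (\<chi> i. v $ i - (\<Sum>l\<in>UNIV. v $ l) / real CARD('n))"

definition standardize :: "real ^ 'n \<Rightarrow> real ^ 'n" where
  "standardize v = (1 / norm (center v)) *\<^sub>R center v"

definition step_fun :: "real ^ 'n \<Rightarrow> real \<Rightarrow> real ^ 'n" where
  "step_fun x u = (\<chi> i. if x $ i > u then 1 else 0)"

definition step_basis :: "real ^ 'n \<Rightarrow> real ^ 'k \<Rightarrow> real ^ 'k ^ 'n" where
  "step_basis x t = (\<chi> i j. standardize (step_fun x (t $ j)) $ i)"


section \<open>Submatrices indexed by a subset\<close>

text \<open>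
  A matrix or vector whose columns or rows are indexed by a subset \<open>A\<close> of the index type is
  represented by its extension by zero to the whole index type. Sums, products and transposes
  commute with this extension, and the identity matrix indexed by \<open>A\<close> becomes
  \<open>diag_on A (\<lambda>_. 1)\<close>. Inversion is therefore taken in the algebra of
  matrices that vanish outside \<open>A \<times> A\<close>, not in the algebra of all matrices.
\<close>

definition sub_columns :: "'k set \<Rightarrow> real ^ 'k ^ 'n \<Rightarrow> real ^ 'k ^ 'n" where
  "sub_columns A X = (\<chi> i j. if j \<in> A then X $ i $ j else 0)"

definition diag_on :: "'k set \<Rightarrow> ('k \<Rightarrow> real) \<Rightarrow> real ^ 'k ^ 'k" where
  "diag_on A s = (\<chi> i j. if i = j \<and> i \<in> A then s i else 0)"

definition inverse_on :: "'k set \<Rightarrow> real ^ 'k ^ 'k \<Rightarrow> real ^ 'k ^ 'k" where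
  "inverse_on A G = (THE M. (\<forall>i j. i \<notin> A \<or> j \<notin> A \<longrightarrow> M $ i $ j = 0) \<and>
     M ** G = diag_on A (\<lambda>_. 1) \<and> G ** M = diag_on A (\<lambda>_. 1))"


section \<open>Coefficient paths\<close>

text \<open>
  A coefficient path is a curve \<open>\<gamma> :: real \<Rightarrow> real ^ 'k\<close> of which only the values at parameters
  \<open>s \<ge> 0\<close> matter. The lasso path is parametrized by the bound on the \<open>L\<^sub>1\<close> norm, the forward
  stagewise path by the number of steps times the step size, and the least angle regression path
  by the \<open>L\<^sub>1\<close> length travelled, staying constant after the full least squares solution.
\<close>

definition rss :: "real ^ 'k ^ 'n \<Rightarrow> real ^ 'n \<Rightarrow> real ^ 'k \<Rightarrow> real" where
  "rss X y b = (norm (y - X *v b))\<^sup>2"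

definition l1_norm :: "real ^ 'k \<Rightarrow> real" where
  "l1_norm b = (\<Sum>j\<in>UNIV. \<bar>b $ j\<bar>)"

definition lasso_path ::
  "real ^ 'k ^ 'n \<Rightarrow> real ^ 'n \<Rightarrow> (real \<Rightarrow> real ^ 'k) \<Rightarrow> bool" where
  "lasso_path X y \<gamma> \<longleftrightarrow> (\<forall>s\<ge>0. is_arg_min (rss X y) (\<lambda>b. l1_norm b \<le> s) (\<gamma> s))"

text \<open>Component \<open>j\<close> is the inner product of predictor \<open>j\<close> with the residual at \<open>b\<close>.\<close>

definition resid_corr :: "real ^ 'k ^ 'n \<Rightarrow> real ^ 'n \<Rightarrow> real ^ 'k \<Rightarrow> real ^ 'k" where
  "resid_corr X y b = transpose X *v (y - X *v b)"

definition max_abs_indices :: "real ^ 'k \<Rightarrow> 'k set" where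
  "max_abs_indices c = {j. \<forall>i. \<bar>c $ i\<bar> \<le> \<bar>c $ j\<bar>}"

text \<open>
  Predictors maximizing the absolute inner product may be tied, so the runs with step size
  \<open>\<epsilon>\<close> form a relation. The limit below is required for every way of breaking ties; after
  \<open>n\<close> steps of size \<open>\<epsilon>\<close> the parameter is \<open>n * \<epsilon>\<close>.
\<close>

definition stagewise_run ::
  "real ^ 'k ^ 'n \<Rightarrow> real ^ 'n \<Rightarrow> real \<Rightarrow> (nat \<Rightarrow> real ^ 'k) \<Rightarrow> bool" where
  "stagewise_run X y \<epsilon> b \<longleftrightarrow> b 0 = 0 \<and>
     (\<forall>n. \<exists>j \<in> max_abs_indices (resid_corr X y (b n)).
        b (Suc n) = b n + axis j (\<epsilon> * sgn (resid_corr X y (b n) $ j)))"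

definition fs0_path ::
  "real ^ 'k ^ 'n \<Rightarrow> real ^ 'n \<Rightarrow> (real \<Rightarrow> real ^ 'k) \<Rightarrow> bool" where
  "fs0_path X y \<gamma> \<longleftrightarrow> (\<forall>b. (\<forall>\<epsilon>>0. stagewise_run X y \<epsilon> (b \<epsilon>)) \<longrightarrow>
     (\<forall>T\<ge>0. uniform_limit {0..T} (\<lambda>\<epsilon> s. b \<epsilon> (nat \<lfloor>s / \<epsilon>\<rfloor>)) \<gamma> (at_right 0)))"

text \<open>The indices outside \<open>A\<close> whose absolute entry of \<open>c\<close> is as large as those in \<open>A\<close>.\<close>

definition caught_up :: "'k set \<Rightarrow> real ^ 'k \<Rightarrow> 'k set" where
  "caught_up A c = {j. j \<notin> A \<and> (\<forall>i\<in>A. \<bar>c $ i\<bar> \<le> \<bar>c $ j\<bar>)}"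

text \<open>
  From coefficients \<open>b\<close> with active set \<open>A\<close>, let \<open>d\<close> be the least squares coefficient of the
  current residual on the predictors in \<open>A\<close>.  The coefficients move to \<open>b + a d\<close>, where \<open>a\<close> is the
  first time some predictor outside \<open>A\<close> catches up, or \<open>1\<close> if none does before the least squares
  fit on \<open>A\<close> is reached. All predictors catching up at that moment become active.
\<close>

definition lar_step ::
  "real ^ 'k ^ 'n \<Rightarrow> real ^ 'n \<Rightarrow> real ^ 'k \<Rightarrow> 'k set \<Rightarrow> real ^ 'k \<Rightarrow> 'k set \<Rightarrow> bool" where
  "lar_step X y b A b' A' \<longleftrightarrow> (\<exists>d a.
     is_arg_min (rss X (y - X *v b)) (\<lambda>d. \<forall>j. j \<notin> A \<longrightarrow> d $ j = 0) d \<and>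
     0 \<le> a \<and> a \<le> 1 \<and>
     (\<forall>a'. 0 \<le> a' \<and> a' < a \<longrightarrow> caught_up A (resid_corr X y (b + a' *\<^sub>R d)) = {}) \<and>
     (caught_up A (resid_corr X y (b + a *\<^sub>R d)) \<noteq> {} \<or> a = 1) \<and>
     b' = b + a *\<^sub>R d \<and>
     A' = A \<union> caught_up A (resid_corr X y b'))"

definition full_ls :: "real ^ 'k ^ 'n \<Rightarrow> real ^ 'n \<Rightarrow> real ^ 'k \<Rightarrow> bool" where
  "full_ls X y b \<longleftrightarrow> is_arg_min (rss X y) (\<lambda>_. True) b"

text \<open>\<open>p 0, \<dots>, p m\<close> are the successive breakpoints of the path.\<close>

definition lar_run ::
  "real ^ 'k ^ 'n \<Rightarrow> real ^ 'n \<Rightarrow> nat \<Rightarrow> (nat \<Rightarrow> real ^ 'k) \<Rightarrow> bool" where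
  "lar_run X y m p \<longleftrightarrow> (\<exists>A. p 0 = 0 \<and> A 0 = max_abs_indices (resid_corr X y 0) \<and>
     (\<forall>i<m. \<not> full_ls X y (p i) \<and> lar_step X y (p i) (A i) (p (Suc i)) (A (Suc i))) \<and>
     full_ls X y (p m))"

definition polygon_length :: "(nat \<Rightarrow> real ^ 'k) \<Rightarrow> nat \<Rightarrow> real" where
  "polygon_length p i = (\<Sum>l<i. l1_norm (p (Suc l) - p l))"

definition traverses_polygon :: "(real \<Rightarrow> real ^ 'k) \<Rightarrow> nat \<Rightarrow> (nat \<Rightarrow> real ^ 'k) \<Rightarrow> bool" where
  "traverses_polygon \<gamma> m p \<longleftrightarrow>
     (\<forall>i<m. \<forall>a\<in>{0..1}. \<gamma> (linepath (polygon_length p i) (polygon_length p (Suc i)) a)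
                      = linepath (p i) (p (Suc i)) a) \<and>
     (\<forall>s\<ge>polygon_length p m. \<gamma> s = p m)"

definition lar_path ::
  "real ^ 'k ^ 'n \<Rightarrow> real ^ 'n \<Rightarrow> (real \<Rightarrow> real ^ 'k) \<Rightarrow> bool" where
  "lar_path X y \<gamma> \<longleftrightarrow> (\<exists>m p. lar_run X y m p \<and> traverses_polygon \<gamma> m p)"

end

theory Submission imports Defs begin

text \<open>
  The step functions of two knots have nested supports, so with \<open>u j = sqrt (S j / (N - S j))\<close>, where
  \<open>S j\<close> counts the observations above the knot \<open>j\<close>, the Gram matrix has the entries
  \<open>min (u i / u j) (u j / u i)\<close>. This is the covariance matrix of a stationary Markov chain; its
  inverse is tridiagonal in the order of the \<open>u j\<close>, and diagonally dominant because
  \<open>\<rho> / (1 + \<rho>) \<le> 1 / 2\<close> for each of the two neighbours.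

  By this cone condition every active coefficient moves in the direction of its sign along the least
  angle path. Hence the sum of the coefficients weighted by these signs is the length travelled,
  which makes the coefficients optimal for the lasso by \<open>L\<^sub>1\<close>/\<open>L\<^sub>\<infinity>\<close> duality.
  Moreover the residual descends the convex function \<open>infnorm (X\<^sup>T r)\<close> along its subgradients,
  whereas forward stagewise regression is the explicit Euler scheme with step size \<open>\<epsilon>\<close> for this
  flow. The square of the distance of the two residuals after \<open>n\<close> steps is at most \<open>n \<epsilon>\<^sup>2\<close>,
  which tends to zero on bounded intervals, however ties are broken.
\<close>

section \<open>Gram matrices of step functions\<close>

text \<open>For \<open>u i = exp (a i)\<close> this is \<open>exp (- \<bar>a i - a l\<bar>)\<close>,
  the exponential covariance kernel at the points \<open>a i\<close> of the line.\<close>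

definition ratio_kernel :: "('k \<Rightarrow> real) \<Rightarrow> 'k \<Rightarrow> 'k \<Rightarrow> real" where
  "ratio_kernel u i l = min (u i / u l) (u l / u i)"

lemma ratio_kernel_le:
  assumes "0 < u i" "u i \<le> u l"
  shows "ratio_kernel u i l = u i / u l" "ratio_kernel u l i = u i / u l"
proof -
  have "u i / u l \<le> 1" "1 \<le> u l / u i"
    using assms by (simp_all add: divide_le_eq_1 le_divide_eq_1)
  then show "ratio_kernel u i l = u i / u l" "ratio_kernel u l i = u i / u l"
    by (auto simp: ratio_kernel_def)
qed

text \<open>Inverting \<open>u\<close> reverses the order of the points, so a bound for the sum over
  the points below \<open>j\<close> also serves for the points above.\<close>

lemma ratio_kernel_inverse: "ratio_kernel (\<lambda>i. inverse (u i)) = ratio_kernel u"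
  by (intro ext) (simp add: ratio_kernel_def field_simps min.commute)

text \<open>Only the nearest neighbour \<open>p\<close> of \<open>j\<close> from below matters, since
  \<open>ratio_kernel u j l = (u p / u j) * ratio_kernel u p l\<close> for all \<open>l\<close> below \<open>j\<close>.\<close>

lemma ratio_kernel_lower_sum:
  assumes "finite A" "j \<in> A" "0 \<le> \<mu>"
    and pos: "\<And>i. i \<in> A \<Longrightarrow> 0 < u i"
    and s: "\<And>i. i \<in> A \<Longrightarrow> s i \<in> {-1, 1}"
    and eq: "\<And>i. i \<in> A \<Longrightarrow> (\<Sum>l\<in>A. ratio_kernel u i l * d l) = \<mu> * s i"
  shows "s j * (\<Sum>l\<in>{l \<in> A. u l < u j}. ratio_kernel u j l * d l) \<le> \<mu> / 2"
proof (cases "{l \<in> A. u l < u j} = {}")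
  case True
  then show ?thesis using \<open>0 \<le> \<mu>\<close> by (simp only: True) simp
next
  case False
  define B where "B = {l \<in> A. u l < u j}"
  have finB: "finite B" "B \<subseteq> A" using \<open>finite A\<close> by (auto simp: B_def)
  have "Max (u ` B) \<in> u ` B" using finB False by (intro Max_in) (auto simp: B_def)
  then obtain p where p: "p \<in> B" "u p = Max (u ` B)" by auto
  have pmax: "u l \<le> u p" if "l \<in> B" for l using that p(2) finB by simp
  define \<rho> where "\<rho> = u p / u j"
  have pA: "p \<in> A" "u p < u j" using p by (auto simp: B_def)
  have \<rho>: "0 < \<rho>" "\<rho> < 1" using pA pos[OF \<open>j \<in> A\<close>] pos[of p] by (auto simp: \<rho>_def)
  define L where "L = (\<Sum>l\<in>B. ratio_kernel u j l * d l)"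
  define R where "R = (\<Sum>l\<in>A - B. ratio_kernel u j l * d l)"
  have split: "(\<Sum>l\<in>A. f l) = (\<Sum>l\<in>B. f l) + (\<Sum>l\<in>A - B. f l)" for f :: "'a \<Rightarrow> real"
    using finB \<open>finite A\<close> by (metis add.commute sum.subset_diff)
  have below: "ratio_kernel u j l = \<rho> * ratio_kernel u p l" if "l \<in> B" for l
  proof -
    have "0 < u l" "u l < u j" using that pos by (auto simp: B_def)
    then show ?thesis
      using ratio_kernel_le[of u l p] ratio_kernel_le[of u l j] pmax[OF that] \<rho>
        pos[OF pA(1)] by (simp add: \<rho>_def)
  qed
  have above: "ratio_kernel u p l = \<rho> * ratio_kernel u j l" if "l \<in> A - B" for l
  proof -
    have "u j \<le> u l" using that by (auto simp: B_def)
    then show ?thesis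
      using ratio_kernel_le[of u j l] ratio_kernel_le[of u p l] pA pos[OF pA(1)] pos[OF \<open>j \<in> A\<close>]
      by (simp add: \<rho>_def)
  qed
  \<comment> \<open>Rows \<open>j\<close> and \<open>p\<close> of the system involve the unknowns
    only through \<open>L\<close> and \<open>R\<close>, so eliminating \<open>R\<close> determines
    \<open>L\<close>.\<close>
  have j: "L + R = \<mu> * s j"
    using eq[OF \<open>j \<in> A\<close>] by (simp add: split L_def R_def)
  have "\<mu> * s p = (\<Sum>l\<in>B. ratio_kernel u p l * d l) + (\<Sum>l\<in>A - B. ratio_kernel u p l * d l)"
    using eq[OF pA(1)] by (simp add: split)
  also have "(\<Sum>l\<in>B. ratio_kernel u p l * d l) = L / \<rho>"
    unfolding L_def sum_divide_distrib using \<rho> by (intro sum.cong) (auto simp: below)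
  also have "(\<Sum>l\<in>A - B. ratio_kernel u p l * d l) = \<rho> * R"
    unfolding R_def sum_distrib_left by (intro sum.cong) (auto simp: above)
  finally have "\<rho> * (\<mu> * s p) = L + \<rho> * (\<rho> * R)" using \<rho> by (simp add: field_simps)
  also have "R = \<mu> * s j - L" using j by simp
  finally have "L * (1 - \<rho>\<^sup>2) = \<mu> * (\<rho> * s p - \<rho>\<^sup>2 * s j)"
    by (simp add: power2_eq_square algebra_simps)
  then have "s j * (L * (1 - \<rho>\<^sup>2)) = s j * (\<mu> * (\<rho> * s p - \<rho>\<^sup>2 * s j))" by simp
  then have "s j * L * (1 - \<rho>\<^sup>2) = \<mu> * (\<rho> * (s p * s j) - \<rho>\<^sup>2 * (s j * s j))"
    by (simp only: right_diff_distrib mult_ac)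
  also have "\<dots> \<le> \<mu> * (\<rho> - \<rho>\<^sup>2)"
    using s[OF \<open>j \<in> A\<close>] s[OF pA(1)] \<rho> \<open>0 \<le> \<mu>\<close> by (intro mult_left_mono) auto
  \<comment> \<open>After division by \<open>1 - \<rho>\<^sup>2\<close> this is the bound
    \<open>\<rho> / (1 + \<rho>) \<le> 1 / 2\<close>.\<close>
  also have "\<dots> \<le> \<mu> * ((1 - \<rho>\<^sup>2) / 2)"
  proof (intro mult_left_mono[OF _ \<open>0 \<le> \<mu>\<close>])
    show "\<rho> - \<rho>\<^sup>2 \<le> (1 - \<rho>\<^sup>2) / 2"
      using zero_le_power2[of "\<rho> - 1"] by (simp add: power2_eq_square algebra_simps)
  qed
  finally have "s j * L * (1 - \<rho>\<^sup>2) \<le> \<mu> / 2 * (1 - \<rho>\<^sup>2)" by simp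
  moreover have "0 < 1 - \<rho>\<^sup>2" using \<rho> by (simp add: power_less_one_iff)
  ultimately show ?thesis unfolding L_def B_def by (simp add: mult_le_cancel_right)
qed

text \<open>Multiply row \<open>j\<close> by \<open>s j\<close>: the right-hand side becomes
  \<open>\<mu>\<close>, the points below and above take at most \<open>\<mu> / 2\<close> each, and
  the unit diagonal leaves \<open>s j * d j\<close>. By injectivity of \<open>u\<close> no other
  point is level with \<open>j\<close>.\<close>

lemma ratio_kernel_cone:
  assumes "finite A" "j \<in> A" "0 \<le> \<mu>"
    and pos: "\<And>i. i \<in> A \<Longrightarrow> 0 < u i" and inj: "inj_on u A"
    and s: "\<And>i. i \<in> A \<Longrightarrow> s i \<in> {-1, 1}"
    and eq: "\<And>i. i \<in> A \<Longrightarrow> (\<Sum>l\<in>A. ratio_kernel u i l * d l) = \<mu> * s i"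
  shows "0 \<le> s j * d j"
proof -
  let ?f = "\<lambda>l. ratio_kernel u j l * d l"
  define B where "B = {l \<in> A. u l < u j}"
  define C where "C = {l \<in> A. inverse (u l) < inverse (u j)}"
  have C: "C = {l \<in> A. u j < u l}"
    using pos \<open>j \<in> A\<close> by (auto simp: C_def inverse_less_iff_less)
  have lower: "s j * sum ?f B \<le> \<mu> / 2"
    unfolding B_def by (intro ratio_kernel_lower_sum assms)
  have upper: "s j * sum ?f C \<le> \<mu> / 2"
    using ratio_kernel_lower_sum[of A j \<mu> "\<lambda>i. inverse (u i)" s d] assms
    unfolding C_def ratio_kernel_inverse by auto
  have A: "A = insert j (B \<union> C)"
    using inj \<open>j \<in> A\<close> by (auto simp: B_def C inj_on_def not_less order.order_iff_strict)
  have "sum ?f A = ?f j + sum ?f (B \<union> C)"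
    unfolding A using \<open>finite A\<close> by (intro sum.insert) (auto simp: B_def C)
  also have "sum ?f (B \<union> C) = sum ?f B + sum ?f C"
    using \<open>finite A\<close> by (intro sum.union_disjoint) (auto simp: B_def C)
  also have "?f j = d j" using pos[OF \<open>j \<in> A\<close>] by (simp add: ratio_kernel_def)
  finally have "\<mu> * s j = d j + (sum ?f B + sum ?f C)"
    using eq[OF \<open>j \<in> A\<close>] by simp
  then have "s j * (\<mu> * s j) = s j * d j + s j * sum ?f B + s j * sum ?f C"
    by (simp only: distrib_left add.assoc)
  moreover have "s j * (\<mu> * s j) = \<mu>" using s[OF \<open>j \<in> A\<close>] by auto
  ultimately show ?thesis using lower upper by linarith
qed

section \<open>Inner products of standardized step functions\<close>

lemma inner_center:
  fixes a b :: "real ^ 'n"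
  shows "center a \<bullet> center b
    = a \<bullet> b - (\<Sum>i\<in>UNIV. a $ i) * (\<Sum>i\<in>UNIV. b $ i) / real CARD('n)"
  by (simp add: center_def inner_vec_def algebra_simps sum.distrib sum_subtractf
      sum_distrib_left[symmetric] sum_distrib_right[symmetric] sum_divide_distrib[symmetric])

text \<open>The supports are nested, so the product is the step function with the higher knot, whose
  sum is the smaller one.\<close>

lemma inner_step_fun:
  fixes x :: "real ^ 'n"
  shows "step_fun x v \<bullet> step_fun x w
    = min (\<Sum>i\<in>UNIV. step_fun x v $ i) (\<Sum>i\<in>UNIV. step_fun x w $ i)"
proof (induction v w rule: linorder_wlog)
  case (le v w)
  have "step_fun x v \<bullet> step_fun x w = (\<Sum>i\<in>UNIV. step_fun x w $ i)"
    using le by (auto simp: inner_vec_def step_fun_def intro!: sum.cong)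
  moreover have "(\<Sum>i\<in>UNIV. step_fun x w $ i) \<le> (\<Sum>i\<in>UNIV. step_fun x v $ i)"
    using le by (intro sum_mono) (auto simp: step_fun_def)
  ultimately show ?case by simp
next
  case (sym v w)
  then show ?case by (simp add: inner_commute min.commute)
qed

text \<open>For \<open>S i \<le> S j\<close> the centered inner product factors as
  \<open>S i * (N - S j) / N\<close>, and dividing by the two norms leaves \<open>u i / u j\<close>,
  where \<open>u j\<close> is the square root of the odds of lying above knot
  \<open>j\<close>.\<close>

lemma step_basis_gram:
  fixes x :: "real ^ 'n" and t :: "real ^ 'k"
  assumes well_defined: "\<And>j. center (step_fun x (t $ j)) \<noteq> 0"
  obtains u where "\<And>j. 0 < u j"
    "\<And>i j. column i (step_basis x t) \<bullet> column j (step_basis x t) = ratio_kernel u i j"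
proof -
  define N where "N = real CARD('n)"
  have N: "0 < N" by (simp add: N_def)
  define S where "S j = (\<Sum>i\<in>UNIV. step_fun x (t $ j) $ i)" for j
  define c where "c j = center (step_fun x (t $ j))" for j
  define u where "u j = sqrt (S j / (N - S j))" for j
  have S0: "0 \<le> S j" for j by (auto simp: S_def step_fun_def intro!: sum_nonneg)
  have inner: "c i \<bullet> c j = min (S i) (S j) - S i * S j / N" for i j
    by (simp add: c_def inner_center inner_step_fun S_def N_def)
  have sq: "c j \<bullet> c j = S j * (N - S j) / N" for j
    using N by (simp add: inner field_simps)
  \<comment> \<open>A nonzero centered step function is not constant, so each knot has observations
    on both sides.\<close>
  have S: "0 < S j" "S j < N" for j
  proof -
    have "0 < c j \<bullet> c j" using well_defined[of j] by (simp add: c_def)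
    then have "0 < S j * (N - S j)" using N by (simp add: sq zero_less_divide_iff)
    then show "0 < S j" "S j < N" using S0[of j] by (auto simp: zero_less_mult_iff)
  qed
  have nc: "norm (c j) = sqrt (S j * (N - S j) / N)" for j
    by (simp add: norm_eq_sqrt_inner sq)
  have col: "column j (step_basis x t) = (1 / norm (c j)) *\<^sub>R c j" for j
    by (simp add: vec_eq_iff column_def step_basis_def standardize_def c_def)
  have u: "0 < u j" for j using S[of j] by (simp add: u_def)
  have le: "column i (step_basis x t) \<bullet> column j (step_basis x t) = ratio_kernel u i j"
    if le: "S i \<le> S j" for i j
  proof -
    have u_le: "u i \<le> u j"
      using le S[of i] S[of j] by (auto simp: u_def intro!: frac_le)
    have "c i \<bullet> c j = S i * (N - S j) / N" using le N by (simp add: inner field_simps)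
    then have "column i (step_basis x t) \<bullet> column j (step_basis x t)
        = (S i * (N - S j) / N) / (norm (c i) * norm (c j))"
      by (simp add: col)
    also have "\<dots> = u i / u j"
    proof -
      \<comment> \<open>With names for the square roots the claim is an identity of rational
        functions.\<close>
      define a b where "a = sqrt (S i)" and "b = sqrt (N - S j)"
      define e f where "e = sqrt (S j)" and "f = sqrt (N - S i)"
      define g where "g = sqrt N"
      have "0 < a" "0 < b" "0 < e" "0 < f" "0 < g"
        using S[of i] S[of j] N by (auto simp: a_def b_def e_def f_def g_def)
      then have "(a * a * (b * b) / (g * g)) / ((a * f / g) * (e * b / g)) = (a / f) / (e / b)"
        by (simp add: field_simps)
      moreover have "S i * (N - S j) / N = a * a * (b * b) / (g * g)"
        using S[of i] S[of j] N by (simp add: a_def b_def g_def)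
      moreover have "norm (c i) = a * f / g" "norm (c j) = e * b / g" "u i = a / f" "u j = e / b"
        by (simp_all add: nc u_def a_def b_def e_def f_def g_def real_sqrt_mult real_sqrt_divide)
      ultimately show ?thesis by (simp only:)
    qed
    also have "\<dots> = ratio_kernel u i j" using ratio_kernel_le(1)[of u i j] u u_le by simp
    finally show ?thesis .
  qed
  have "column i (step_basis x t) \<bullet> column j (step_basis x t) = ratio_kernel u i j" for i j
    using le[of i j] le[of j i]
    by (metis inner_commute linear ratio_kernel_def min.commute)
  with u show thesis using that by blast
qed


section \<open>Inverse Gram matrices on a set of columns\<close>

lemma transpose_mult_inner:
  fixes X :: "real ^ 'k ^ 'n"
  shows "(transpose X *v z) \<bullet> b = z \<bullet> (X *v b)"
  by (simp add: dot_lmul_matrix)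

lemma transpose_mult_nth:
  fixes X :: "real ^ 'k ^ 'n"
  shows "(transpose X *v z) $ j = column j X \<bullet> z"
  by (simp add: matrix_vector_mult_def transpose_def column_def inner_vec_def del: transpose_matrix_vector)

lemma diag_on_mult_nth: "(diag_on A s *v v) $ j = (if j \<in> A then s j * v $ j else 0)"
  by (simp add: diag_on_def matrix_vector_mult_def if_distrib[of "\<lambda>a. a * _"] cong: if_cong)

lemma diag_on_one_mult:
  assumes "\<And>j. j \<notin> A \<Longrightarrow> v $ j = 0"
  shows "diag_on A (\<lambda>_. 1) *v v = v"
  using assms by (auto simp: vec_eq_iff diag_on_mult_nth)

text \<open>Restriction to \<open>A\<close> becomes multiplication by a coordinate projection, so
  submatrices can be handled by matrix algebra.\<close>

lemma sub_columns_eq: "sub_columns A X = X ** diag_on A (\<lambda>_. 1)"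
  by (simp add: vec_eq_iff sub_columns_def matrix_matrix_mult_def diag_on_def
      if_distrib[of "\<lambda>a. _ * a"] cong: if_cong conj_cong)

lemma transpose_diag_on: "transpose (diag_on A s) = diag_on A s"
  by (auto simp: vec_eq_iff transpose_def diag_on_def)

lemma sub_gram_mult:
  fixes X :: "real ^ 'k ^ 'n"
  shows "(transpose (sub_columns A X) ** sub_columns A X) *v v
    = diag_on A (\<lambda>_. 1) *v (transpose X *v (X *v (diag_on A (\<lambda>_. 1) *v v)))"
  by (simp add: sub_columns_eq matrix_transpose_mul transpose_diag_on matrix_vector_mul_assoc
      matrix_mul_assoc del: transpose_matrix_vector)

text \<open>Uniqueness of inverses in the algebra with unit
  \<open>diag_on A (\<lambda>_. 1)\<close>; vanishing outside \<open>A\<close> is what makes this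
  projection act as a unit.\<close>

lemma inverse_on_eqI:
  assumes "\<And>i j. i \<notin> A \<or> j \<notin> A \<Longrightarrow> M $ i $ j = 0"
    and "M ** G = diag_on A (\<lambda>_. 1)" "G ** M = diag_on A (\<lambda>_. 1)"
  shows "inverse_on A G = M"
  unfolding inverse_on_def
proof (rule the_equality)
  fix M'
  assume M': "(\<forall>i j. i \<notin> A \<or> j \<notin> A \<longrightarrow> M' $ i $ j = 0) \<and>
     M' ** G = diag_on A (\<lambda>_. 1) \<and> G ** M' = diag_on A (\<lambda>_. 1)"
  have left: "diag_on A (\<lambda>_. 1) ** K = K" if "\<And>i j. i \<notin> A \<Longrightarrow> K $ i $ j = 0" for K :: "real ^ 'a ^ 'a"
  proof -
    have "(diag_on A (\<lambda>_. 1) ** K) $ i $ j = K $ i $ j" for i j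
      using that[of i j] by (cases "i \<in> A")
        (simp_all add: matrix_matrix_mult_def diag_on_def if_distrib[of "\<lambda>a. a * _"] cong: if_cong)
    then show ?thesis by (simp add: vec_eq_iff)
  qed
  have right: "K ** diag_on A (\<lambda>_. 1) = K" if "\<And>i j. j \<notin> A \<Longrightarrow> K $ i $ j = 0" for K :: "real ^ 'a ^ 'a"
  proof -
    have "(K ** diag_on A (\<lambda>_. 1)) $ i $ j = K $ i $ j" for i j
      using that[of j i] by (cases "j \<in> A")
        (simp_all add: matrix_matrix_mult_def diag_on_def if_distrib[of "\<lambda>a. _ * a"]
          cong: if_cong conj_cong)
    then show ?thesis by (simp add: vec_eq_iff)
  qed
  have "M' = M' ** (G ** M)" using M' assms right[of M'] by auto
  also have "\<dots> = (M' ** G) ** M" by (simp add: matrix_mul_assoc)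
  also have "\<dots> = M" using M' assms left[of M] by auto
  finally show "M' = M" .
qed (use assms in auto)

text \<open>\<open>H\<close> is block diagonal, with the Gram matrix on \<open>A\<close> and the
  identity on the complement. It is invertible, and its inverse cut down to \<open>A\<close> is the
  required one.\<close>

lemma inverse_on_gram:
  fixes X :: "real ^ 'k ^ 'n" and A :: "'k set"
  assumes inj: "inj ((*v) X)"
  defines "G \<equiv> transpose (sub_columns A X) ** sub_columns A X"
  shows "\<And>i j. i \<notin> A \<or> j \<notin> A \<Longrightarrow> inverse_on A G $ i $ j = 0"
    and "inverse_on A G ** G = diag_on A (\<lambda>_. 1)"
    and "G ** inverse_on A G = diag_on A (\<lambda>_. 1)"
proof -
  define D where "D = (diag_on A (\<lambda>_. 1) :: real ^ 'k ^ 'k)"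
  define E where "E = (diag_on (- A) (\<lambda>_. 1) :: real ^ 'k ^ 'k)"
  define H where "H = G + E"
  have DD: "D ** D = D" and DE: "D ** E = 0" and ED: "E ** D = 0"
    unfolding matrix_eq D_def E_def
    by (auto simp: matrix_vector_mul_assoc[symmetric] vec_eq_iff diag_on_mult_nth)
  have DG: "D ** G = G" and GD: "G ** D = G"
    unfolding G_def sub_columns_eq
    by (simp_all add: D_def[symmetric] matrix_transpose_mul transpose_diag_on matrix_mul_assoc DD)
       (metis D_def DD matrix_mul_assoc transpose_diag_on)+
  \<comment> \<open>Applying \<open>D\<close> separates the two blocks: \<open>v\<close> vanishes
    outside \<open>A\<close>, and the block on \<open>A\<close> gives
    \<open>(X *v v) \<bullet> (X *v v) = 0\<close>.\<close>
  have "v = 0" if "H *v v = 0" for v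
  proof -
    have HG: "G *v v + E *v v = 0" using that by (simp add: H_def matrix_vector_mult_add_rdistrib)
    then have "D *v (G *v v + E *v v) = 0" by simp
    then have G0: "G *v v = 0"
      by (simp add: matrix_vector_right_distrib matrix_vector_mul_assoc DG DE)
    then have E0: "E *v v = 0" using HG by simp
    have "v $ j = 0" if "j \<notin> A" for j
      using arg_cong[OF E0, of "\<lambda>w. w $ j"] that by (simp add: E_def diag_on_mult_nth)
    then have Dv: "D *v v = v" unfolding D_def by (rule diag_on_one_mult)
    have "0 = (D *v (transpose X *v (X *v (D *v v)))) \<bullet> v"
      using G0 by (simp add: G_def sub_gram_mult D_def del: transpose_matrix_vector)
    also have "\<dots> = (transpose X *v (X *v v)) \<bullet> (D *v v)"
      by (metis D_def Dv transpose_diag_on transpose_mult_inner)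
    also have "\<dots> = (X *v v) \<bullet> (X *v v)"
      by (simp add: Dv transpose_mult_inner del: transpose_matrix_vector)
    finally have "X *v v = X *v 0" by simp
    then show "v = 0" by (rule injD[OF inj])
  qed
  then obtain H' where H': "H' ** H = mat 1"
    using matrix_left_invertible_ker[of H] by auto
  then have H'': "H ** H' = mat 1" using matrix_left_right_inverse by blast
  have add_mult: "(G + E) ** D = G ** D + E ** D"
    by (simp add: matrix_eq matrix_vector_mul_assoc[symmetric] matrix_vector_mult_add_rdistrib)
  have HD: "H ** D = G" "D ** H = G"
    by (simp_all add: H_def matrix_add_ldistrib add_mult DE ED DG GD)
  define M where "M = H' ** D"
  \<comment> \<open>\<open>D\<close> commutes with \<open>H\<close>, hence with its inverse, so
    \<open>M\<close> can be cut down from either side.\<close>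
  have MD: "M = D ** H'"
  proof -
    have "M = H' ** (D ** (H ** H'))" by (simp add: M_def H'')
    also have "\<dots> = H' ** (H ** D) ** H'" by (simp add: HD matrix_mul_assoc)
    also have "\<dots> = D ** H'" by (simp add: matrix_mul_assoc H')
    finally show ?thesis .
  qed
  have 1: "M ** G = D"
  proof -
    have "M ** G = H' ** (D ** G)" by (simp add: M_def matrix_mul_assoc)
    also have "\<dots> = H' ** (H ** D)" by (simp add: DG HD)
    also have "\<dots> = D" by (simp add: matrix_mul_assoc H')
    finally show ?thesis .
  qed
  have 2: "G ** M = D"
  proof -
    have "G ** M = (G ** D) ** H'" by (simp add: MD matrix_mul_assoc)
    also have "\<dots> = (D ** H) ** H'" by (simp add: GD HD)
    also have "\<dots> = D" by (simp add: matrix_mul_assoc[symmetric] H'')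
    finally show ?thesis .
  qed
  have 3: "M $ i $ j = 0" if "i \<notin> A \<or> j \<notin> A" for i j
  proof -
    have "M $ i $ j = 0" if "i \<notin> A"
      unfolding MD using that by (simp add: D_def matrix_matrix_mult_def diag_on_def)
    moreover have "M $ i $ j = 0" if "j \<notin> A"
      unfolding M_def using that
      by (auto simp add: D_def matrix_matrix_mult_def diag_on_def intro!: sum.neutral)
    ultimately show ?thesis using that by blast
  qed
  have "inverse_on A G = M"
    using 1 2 3 unfolding D_def by (intro inverse_on_eqI)
  with 1 2 3 show "\<And>i j. i \<notin> A \<or> j \<notin> A \<Longrightarrow> inverse_on A G $ i $ j = 0"
    "inverse_on A G ** G = diag_on A (\<lambda>_. 1)" "G ** inverse_on A G = diag_on A (\<lambda>_. 1)"
    by (auto simp: D_def)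
qed

text \<open>Replaces the inverse by a linear system supported on \<open>A\<close>. Both the least
  angle directions and the sign condition of the theorem are treated in this form.\<close>

lemma inverse_on_gram_mult:
  fixes X :: "real ^ 'k ^ 'n" and A :: "'k set"
  assumes inj: "inj ((*v) X)"
  defines "M \<equiv> inverse_on A (transpose (sub_columns A X) ** sub_columns A X)"
  shows "j \<notin> A \<Longrightarrow> (M *v c) $ j = 0"
    and "j \<in> A \<Longrightarrow> (transpose X *v (X *v (M *v c))) $ j = c $ j"
proof -
  note inv = inverse_on_gram[OF inj, where A = A, folded M_def]
  show 0: "(M *v c) $ j = 0" if "j \<notin> A" for j
    using that by (simp add: matrix_vector_mult_def inv(1))
  have D: "diag_on A (\<lambda>_. 1) *v (M *v c) = M *v c"
    using 0 by (rule diag_on_one_mult)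
  have "diag_on A (\<lambda>_. 1) *v c = diag_on A (\<lambda>_. 1) *v (transpose X *v (X *v (M *v c)))"
  proof -
    have "diag_on A (\<lambda>_. 1) *v c
        = (transpose (sub_columns A X) ** sub_columns A X) *v (M *v c)"
      by (simp only: inv(3)[symmetric] matrix_vector_mul_assoc)
    then show ?thesis by (simp only: sub_gram_mult D)
  qed
  then have "(diag_on A (\<lambda>_. 1) *v (transpose X *v (X *v (M *v c)))) $ j = (diag_on A (\<lambda>_. 1) *v c) $ j"
    by simp
  then show "j \<in> A \<Longrightarrow> (transpose X *v (X *v (M *v c))) $ j = c $ j"
    by (simp add: diag_on_mult_nth del: transpose_matrix_vector)
qed


section \<open>Residuals and the maximal absolute correlation\<close>

declare transpose_matrix_vector [simp del]

lemma power2_norm_add: "(norm (u + v))\<^sup>2 = (norm u)\<^sup>2 + 2 * (u \<bullet> v) + (norm v)\<^sup>2"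
  for u v :: "'a :: real_inner"
  by (simp add: power2_norm_eq_inner inner_add_left inner_add_right inner_commute)

lemma resid_corr_add: "resid_corr X y (b + d) = resid_corr X y b - transpose X *v (X *v d)"
  by (simp add: resid_corr_def matrix_vector_right_distrib matrix_vector_mult_diff_distrib diff_diff_eq)

lemma rss_add:
  fixes X :: "real ^ 'k ^ 'n"
  shows "rss X y (b + d) = rss X y b - 2 * (resid_corr X y b \<bullet> d) + (norm (X *v d))\<^sup>2"
proof -
  have "rss X y (b + d) = (norm ((y - X *v b) + - (X *v d)))\<^sup>2"
    by (simp add: rss_def matrix_vector_right_distrib diff_diff_eq)
  then show ?thesis
    unfolding power2_norm_add by (simp add: rss_def resid_corr_def transpose_mult_inner)
qed

lemma mult_axis: "X *v axis j a = a *\<^sub>R column j X" for X :: "real ^ 'k ^ 'n"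
  by (simp add: vec_eq_iff matrix_vector_mult_def column_def axis_def mult.commute
      if_distrib[of "\<lambda>a. _ * a"] cong: if_cong)

lemma infnorm_eqI:
  fixes c :: "real ^ 'k"
  assumes "\<bar>c $ j\<bar> = m" "\<And>i. \<bar>c $ i\<bar> \<le> m"
  shows "infnorm c = m"
  unfolding infnorm_cart using assms by (intro cSup_eq_maximum) auto

lemma max_abs_indices_infnorm:
  assumes "j \<in> max_abs_indices c"
  shows "\<bar>c $ j\<bar> = infnorm c"
  using infnorm_eqI[of c j "\<bar>c $ j\<bar>"] assms by (simp add: max_abs_indices_def)

lemma max_abs_indices_nonempty: "max_abs_indices (c :: real ^ 'k) \<noteq> {}"
proof -
  define M where "M = Max (range (\<lambda>j. \<bar>c $ j\<bar>))"
  have "M \<in> range (\<lambda>j. \<bar>c $ j\<bar>)" unfolding M_def by (intro Max_in) auto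
  then obtain j where "M = \<bar>c $ j\<bar>" by blast
  moreover have "\<bar>c $ i\<bar> \<le> M" for i by (simp add: M_def)
  ultimately have "j \<in> max_abs_indices c" by (simp add: max_abs_indices_def)
  then show ?thesis by blast
qed

text \<open>Hoelder's inequality, the duality behind both lasso optimality and the descent
  inequality.\<close>

lemma inner_le_infnorm_l1: "c \<bullet> b \<le> infnorm c * l1_norm b" for c b :: "real ^ 'k"
proof -
  have "c \<bullet> b \<le> (\<Sum>j\<in>UNIV. infnorm c * \<bar>b $ j\<bar>)"
    unfolding inner_vec_def
  proof (rule sum_mono)
    fix j
    have "c $ j * b $ j \<le> \<bar>c $ j\<bar> * \<bar>b $ j\<bar>" by (metis abs_ge_self abs_mult)
    also have "\<dots> \<le> infnorm c * \<bar>b $ j\<bar>"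
      by (intro mult_right_mono component_le_infnorm_cart) simp
    finally show "c $ j \<bullet> b $ j \<le> infnorm c * \<bar>b $ j\<bar>" by simp
  qed
  then show ?thesis by (simp add: l1_norm_def sum_distrib_left)
qed

lemma l1_norm_scaleR: "l1_norm (a *\<^sub>R b) = \<bar>a\<bar> * l1_norm b"
  by (simp add: l1_norm_def abs_mult sum_distrib_left)

lemma l1_norm_triangle: "l1_norm (a + b) \<le> l1_norm a + l1_norm b"
  unfolding l1_norm_def sum.distrib[symmetric] by (intro sum_mono) (simp add: abs_triangle_ineq)

lemma l1_norm_nonneg: "0 \<le> l1_norm b"
  by (simp add: l1_norm_def sum_nonneg)

lemma l1_norm_le_0D: "l1_norm b \<le> 0 \<Longrightarrow> b = 0"
  using sum_nonneg_eq_0_iff[of UNIV "\<lambda>j. \<bar>b $ j\<bar>"] order.antisym[OF _ l1_norm_nonneg[of b]]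
  by (simp add: l1_norm_def vec_eq_iff)

section \<open>Parametrization of a polygon by its \<open>L\<^sub>1\<close> length\<close>

lemma polygon_length_Suc: "polygon_length p (Suc i) = polygon_length p i + l1_norm (p (Suc i) - p i)"
  by (simp add: polygon_length_def)

lemma polygon_length_nonneg: "0 \<le> polygon_length p i"
  by (simp add: polygon_length_def sum_nonneg l1_norm_nonneg)

text \<open>Segments may have length 0, so \<open>a\<close> is taken from the image of
  \<open>linepath\<close> and not found by division.\<close>

lemma polygon_length_cover:
  assumes "0 \<le> t"
  shows "polygon_length p m \<le> t \<or>
    (\<exists>i<m. \<exists>a\<in>{0..1}. t = linepath (polygon_length p i) (polygon_length p (Suc i)) a)"
proof (induction m)
  case 0
  then show ?case using assms by (simp add: polygon_length_def)
next
  case (Suc m)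
  show ?case
  proof (cases "polygon_length p m \<le> t \<and> t \<le> polygon_length p (Suc m)")
    case True
    then have "t \<in> closed_segment (polygon_length p m) (polygon_length p (Suc m))"
      by (simp add: closed_segment_eq_real_ivl)
    then show ?thesis by (auto simp: linepath_image_01[symmetric])
  next
    case False
    then show ?thesis using Suc by (auto simp: less_Suc_eq)
  qed
qed


section \<open>Least angle regression under the positive cone condition\<close>

text \<open>The cone condition speaks of solutions of a linear system with right-hand side
  \<open>\<mu> * s j\<close>, because this is the form in which a least squares direction arises
  when the active correlations are \<open>\<mu> * s j\<close>.\<close>

locale cone_regression =
  fixes X :: "real ^ 'k ^ 'n" and y :: "real ^ 'n"
  assumes inj_X: "inj ((*v) X)"
    and norm_column: "\<And>j. norm (column j X) = 1"
    and cone: "\<And>A s \<mu> d j. \<lbrakk>0 \<le> \<mu>; \<forall>j. s j \<in> {-1, 1}; \<forall>j. j \<notin> A \<longrightarrow> d $ j = 0;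
      \<forall>j\<in>A. (transpose X *v (X *v d)) $ j = \<mu> * s j; j \<in> A\<rbrakk> \<Longrightarrow> 0 \<le> s j * d $ j"
begin

lemma normal_equations:
  "is_arg_min (rss X r) (\<lambda>d. \<forall>j. j \<notin> A \<longrightarrow> d $ j = 0) d \<longleftrightarrow>
    (\<forall>j. j \<notin> A \<longrightarrow> d $ j = 0) \<and> (\<forall>j\<in>A. resid_corr X r d $ j = 0)"
proof (intro iffI conjI ballI)
  assume min: "is_arg_min (rss X r) (\<lambda>d. \<forall>j. j \<notin> A \<longrightarrow> d $ j = 0) d"
  then show "\<forall>j. j \<notin> A \<longrightarrow> d $ j = 0" by (simp add: is_arg_min_linorder)
  fix j assume "j \<in> A"
  define c where "c = resid_corr X r d $ j"
  \<comment> \<open>Columns have norm 1, so moving coordinate \<open>j\<close> by its own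
    correlation \<open>c\<close> lowers \<open>rss\<close> by exactly
    \<open>c\<^sup>2\<close>.\<close>
  have "rss X r d \<le> rss X r (d + axis j c)"
    using min \<open>j \<in> A\<close> by (auto simp: is_arg_min_linorder axis_def)
  also have "\<dots> = rss X r d - c\<^sup>2"
    by (simp add: rss_add inner_axis c_def[symmetric] mult_axis norm_column power2_eq_square)
  finally have "c = 0" by simp
  then show "resid_corr X r d $ j = 0" by (simp add: c_def)
next
  assume *: "(\<forall>j. j \<notin> A \<longrightarrow> d $ j = 0) \<and> (\<forall>j\<in>A. resid_corr X r d $ j = 0)"
  show "is_arg_min (rss X r) (\<lambda>d. \<forall>j. j \<notin> A \<longrightarrow> d $ j = 0) d"
    unfolding is_arg_min_linorder
  proof (intro conjI allI impI)
    fix d' :: "real ^ 'k" assume d': "\<forall>j. j \<notin> A \<longrightarrow> d' $ j = 0"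
    have "resid_corr X r d \<bullet> (d' - d) = 0"
      unfolding inner_vec_def using * d' by (intro sum.neutral) (metis diff_self inner_zero_left
          inner_zero_right vector_minus_component)
    then have "rss X r (d + (d' - d)) = rss X r d + (norm (X *v (d' - d)))\<^sup>2"
      by (simp only: rss_add)
    then show "rss X r d \<le> rss X r d'" by simp
  qed (use * in auto)
qed

lemma full_ls_iff: "full_ls X y b \<longleftrightarrow> resid_corr X y b = 0"
  using normal_equations[of y UNIV b] by (simp add: full_ls_def vec_eq_iff)

text \<open>The quadratic margin comes from expanding \<open>rss\<close> at a minimizer over a
  convex set; for injective \<open>X\<close> it yields uniqueness at once.\<close>

definition strict_lasso :: "real \<Rightarrow> real ^ 'k \<Rightarrow> bool" where
  "strict_lasso \<tau> b \<longleftrightarrow> l1_norm b \<le> \<tau> \<and>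
    (\<forall>b'. l1_norm b' \<le> \<tau> \<longrightarrow> rss X y b + (norm (X *v (b' - b)))\<^sup>2 \<le> rss X y b')"

lemma X_eq_0D: "X *v d = 0 \<Longrightarrow> d = 0"
  using injD[OF inj_X, of d 0] by simp

lemma strict_lasso_arg_min:
  assumes "strict_lasso \<tau> b"
  shows "is_arg_min (rss X y) (\<lambda>b. l1_norm b \<le> \<tau>) b' \<longleftrightarrow> b' = b"
proof
  assume min: "is_arg_min (rss X y) (\<lambda>b. l1_norm b \<le> \<tau>) b'"
  then have "rss X y b' \<le> rss X y b" "l1_norm b' \<le> \<tau>"
    using assms by (auto simp: is_arg_min_linorder strict_lasso_def)
  moreover from this have "rss X y b + (norm (X *v (b' - b)))\<^sup>2 \<le> rss X y b'"
    using assms by (simp add: strict_lasso_def)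
  ultimately have "(norm (X *v (b' - b)))\<^sup>2 \<le> 0" by linarith
  then show "b' = b" using X_eq_0D[of "b' - b"] by simp
next
  assume "b' = b"
  have "rss X y b \<le> rss X y b''" if "l1_norm b'' \<le> \<tau>" for b''
    using assms that zero_le_power2[of "norm (X *v (b'' - b))"] unfolding strict_lasso_def
    by (meson add_increasing2 order.refl order.trans)
  then show "is_arg_min (rss X y) (\<lambda>b. l1_norm b \<le> \<tau>) b'"
    using assms \<open>b' = b\<close> by (simp add: is_arg_min_linorder strict_lasso_def)
qed

lemma strict_lasso_unique: "strict_lasso \<tau> b \<Longrightarrow> strict_lasso \<tau> b' \<Longrightarrow> b = b'"
  using strict_lasso_arg_min by metis

text \<open>The coefficients \<open>b\<close> are reached at position \<open>\<tau>\<close> with active set \<open>A\<close>, and \<open>\<mu>\<close> is the common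
  absolute correlation of the active predictors.\<close>

definition lar_state :: "'k set \<Rightarrow> ('k \<Rightarrow> real) \<Rightarrow> real \<Rightarrow> real \<Rightarrow> real ^ 'k \<Rightarrow> bool" where
  "lar_state A s \<mu> \<tau> b \<longleftrightarrow> A \<noteq> {} \<and> 0 \<le> \<mu> \<and> (\<forall>j. s j \<in> {-1, 1}) \<and>
    (\<forall>j\<in>A. resid_corr X y b $ j = \<mu> * s j) \<and> (\<forall>j. \<bar>resid_corr X y b $ j\<bar> \<le> \<mu>) \<and>
    (\<forall>j. j \<notin> A \<longrightarrow> b $ j = 0) \<and> l1_norm b \<le> \<tau> \<and> (\<Sum>j\<in>UNIV. s j * b $ j) = \<tau>"

lemma lar_state_infnorm:
  assumes "lar_state A s \<mu> \<tau> b"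
  shows "infnorm (resid_corr X y b) = \<mu>"
proof -
  obtain j where "j \<in> A" using assms by (auto simp: lar_state_def)
  moreover have "\<bar>s j\<bar> = 1" using assms unfolding lar_state_def by (metis abs_1 abs_minus_cancel empty_iff insertE)
  ultimately show ?thesis
    using assms by (intro infnorm_eqI[of _ j]) (auto simp: lar_state_def abs_mult)
qed

lemma lar_state_inner:
  assumes "lar_state A s \<mu> \<tau> b" "\<forall>j. j \<notin> A \<longrightarrow> d $ j = 0"
  shows "resid_corr X y b \<bullet> d = \<mu> * (\<Sum>j\<in>UNIV. s j * d $ j)"
  unfolding inner_vec_def sum_distrib_left
proof (rule sum.cong)
  fix j show "resid_corr X y b $ j \<bullet> d $ j = \<mu> * (s j * d $ j)"
    using assms by (cases "j \<in> A") (auto simp: lar_state_def)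
qed simp

text \<open>The correlations at \<open>b\<close> have inner product \<open>\<mu> * \<tau>\<close>
  with \<open>b\<close> and, by Hoelder, at most that with any \<open>b'\<close> in the ball. So the
  linear term of the expansion at \<open>b\<close> cannot lower \<open>rss\<close>.\<close>

lemma lar_state_strict_lasso:
  assumes st: "lar_state A s \<mu> \<tau> b"
  shows "strict_lasso \<tau> b"
  unfolding strict_lasso_def
proof (intro conjI allI impI)
  show "l1_norm b \<le> \<tau>" using st by (simp add: lar_state_def)
  fix b' :: "real ^ 'k" assume b': "l1_norm b' \<le> \<tau>"
  have "resid_corr X y b \<bullet> b' \<le> \<mu> * l1_norm b'"
    using inner_le_infnorm_l1[of "resid_corr X y b" b'] lar_state_infnorm[OF st] by simp
  also have "\<dots> \<le> \<mu> * \<tau>" using b' st by (intro mult_left_mono) (auto simp: lar_state_def)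
  also have "\<dots> = resid_corr X y b \<bullet> b"
    using lar_state_inner[OF st, of b] st by (simp add: lar_state_def)
  finally have "resid_corr X y b \<bullet> (b' - b) \<le> 0" by (simp add: inner_diff_right)
  moreover have "rss X y (b + (b' - b)) = rss X y b - 2 * (resid_corr X y b \<bullet> (b' - b))
      + (norm (X *v (b' - b)))\<^sup>2" by (rule rss_add)
  ultimately show "rss X y b + (norm (X *v (b' - b)))\<^sup>2 \<le> rss X y b'" by simp
qed

text \<open>The cone condition enters here: \<open>s j * d $ j = \<bar>d $ j\<bar>\<close>, so the
  signed sum of the coefficients grows by the length travelled, while the active correlations shrink
  by the factor \<open>1 - a\<close>.\<close>

lemma lar_state_move:
  assumes st: "lar_state A s \<mu> \<tau> b"
    and d: "\<forall>j. j \<notin> A \<longrightarrow> d $ j = 0" "\<forall>j\<in>A. resid_corr X (y - X *v b) d $ j = 0"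
    and a: "0 \<le> a" "a \<le> 1"
    and le: "\<And>j. j \<notin> A \<Longrightarrow> \<bar>resid_corr X y (b + a *\<^sub>R d) $ j\<bar> \<le> (1 - a) * \<mu>"
  shows "lar_state A s ((1 - a) * \<mu>) (\<tau> + a * l1_norm d) (b + a *\<^sub>R d)"
proof -
  have s: "s j = 1 \<or> s j = -1" for j using st by (auto simp: lar_state_def)
  have G: "(transpose X *v (X *v d)) $ j = \<mu> * s j" if "j \<in> A" for j
    using d(2) st that
    by (auto simp: resid_corr_def lar_state_def matrix_vector_mult_diff_distrib)
  have c: "resid_corr X y (b + a *\<^sub>R d) $ j = (1 - a) * \<mu> * s j" if "j \<in> A" for j
    using st that by (auto simp: resid_corr_add matrix_vector_mult_scaleR G lar_state_def algebra_simps)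
  have pos: "0 \<le> s j * d $ j" if "j \<in> A" for j
    using st G d(1) that by (intro cone[of \<mu> s A]) (auto simp: lar_state_def)
  have sd: "s j * d $ j = \<bar>d $ j\<bar>" for j
    using d(1) s[of j] pos[of j] by (cases "j \<in> A") auto
  have "(\<Sum>j\<in>UNIV. s j * (b + a *\<^sub>R d) $ j) = \<tau> + a * (\<Sum>j\<in>UNIV. s j * d $ j)"
    using st by (simp add: lar_state_def algebra_simps sum.distrib sum_distrib_left)
  then have sum: "(\<Sum>j\<in>UNIV. s j * (b + a *\<^sub>R d) $ j) = \<tau> + a * l1_norm d"
    by (simp only: sd l1_norm_def)
  have "l1_norm (b + a *\<^sub>R d) \<le> \<tau> + a * l1_norm d"
    using l1_norm_triangle[of b "a *\<^sub>R d"] st a by (simp add: l1_norm_scaleR lar_state_def)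
  moreover have "\<bar>resid_corr X y (b + a *\<^sub>R d) $ j\<bar> \<le> (1 - a) * \<mu>" for j
    using le[of j] c[of j] s[of j] st a by (cases "j \<in> A") (auto simp: abs_mult lar_state_def)
  ultimately show ?thesis
    using st d(1) c sum a unfolding lar_state_def by auto
qed

text \<open>The old active set and signs persist on the closed segment. At its end point the state
  is renewed with the enlarged set, the new signs being those of the correlations reached.\<close>

lemma lar_step_state:
  assumes st: "lar_state A s \<mu> \<tau> b" and step: "lar_step X y b A b' A'"
  shows "\<forall>a\<in>{0..1}. \<exists>\<mu>'. lar_state A s \<mu>' (linepath \<tau> (\<tau> + l1_norm (b' - b)) a) (linepath b b' a)"
    and "\<exists>s' \<mu>'. lar_state A' s' \<mu>' (\<tau> + l1_norm (b' - b)) b'"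
proof -
  obtain d \<alpha> where min: "is_arg_min (rss X (y - X *v b)) (\<lambda>d. \<forall>j. j \<notin> A \<longrightarrow> d $ j = 0) d"
    and \<alpha>: "0 \<le> \<alpha>" "\<alpha> \<le> 1"
    and before: "\<And>a. 0 \<le> a \<Longrightarrow> a < \<alpha> \<Longrightarrow> caught_up A (resid_corr X y (b + a *\<^sub>R d)) = {}"
    and b': "b' = b + \<alpha> *\<^sub>R d"
    and A': "A' = A \<union> caught_up A (resid_corr X y b')"
    using step unfolding lar_step_def by blast
  note d = min[unfolded normal_equations]
  have s: "s j = 1 \<or> s j = -1" for j using st by (auto simp: lar_state_def)
  have c: "resid_corr X y (b + a *\<^sub>R d) $ j = resid_corr X y b $ j - a * (transpose X *v (X *v d)) $ j" for a j
    by (simp add: resid_corr_add matrix_vector_mult_scaleR)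
  have cA: "resid_corr X y (b + a *\<^sub>R d) $ j = (1 - a) * \<mu> * s j" if "j \<in> A" for a j
    using st d that unfolding c
    by (auto simp: resid_corr_def lar_state_def matrix_vector_mult_diff_distrib algebra_simps)
  have lt: "\<bar>resid_corr X y (b + a *\<^sub>R d) $ j\<bar> \<le> (1 - a) * \<mu>" if "j \<notin> A" "0 \<le> a" "a < \<alpha>" for a j
  proof -
    have "j \<notin> caught_up A (resid_corr X y (b + a *\<^sub>R d))" using before[of a] that by simp
    then obtain i where "i \<in> A" "\<bar>resid_corr X y (b + a *\<^sub>R d) $ j\<bar> < \<bar>resid_corr X y (b + a *\<^sub>R d) $ i\<bar>"
      using \<open>j \<notin> A\<close> by (auto simp: caught_up_def not_le)
    moreover have "\<bar>resid_corr X y (b + a *\<^sub>R d) $ i\<bar> = (1 - a) * \<mu>"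
      using cA[OF \<open>i \<in> A\<close>, of a] s[of i] that \<alpha> st by (auto simp: abs_mult lar_state_def)
    ultimately show ?thesis by simp
  qed
  \<comment> \<open>The definition of a step excludes catching up only before
    \<open>\<alpha>\<close>. The bound extends to \<open>\<alpha>\<close> by continuity, and for
    \<open>\<alpha> = 0\<close> it is part of the initial state.\<close>
  have le: "\<bar>resid_corr X y (b + a *\<^sub>R d) $ j\<bar> \<le> (1 - a) * \<mu>" if "j \<notin> A" "0 \<le> a" "a \<le> \<alpha>" for a j
  proof (cases "a < \<alpha>")
    case True
    then show ?thesis using lt that by blast
  next
    case False
    then have a: "a = \<alpha>" using that by simp
    show ?thesis
    proof (cases "\<alpha> = 0")
      case True
      then show ?thesis using a st by (simp add: lar_state_def)
    next
      case False
      then have cl: "closure {0..<\<alpha>} = {0..\<alpha>}" using \<alpha> by (intro closure_atLeastLessThan) auto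
      have "\<bar>resid_corr X y b $ j - \<alpha> * (transpose X *v (X *v d)) $ j\<bar> - (1 - \<alpha>) * \<mu> \<le> 0"
      proof (rule continuous_le_on_closure[of "{0..<\<alpha>}"
            "\<lambda>a. \<bar>resid_corr X y b $ j - a * (transpose X *v (X *v d)) $ j\<bar> - (1 - a) * \<mu>"])
        show "\<alpha> \<in> closure {0..<\<alpha>}" using \<alpha> by (simp add: cl)
      qed (use lt[OF \<open>j \<notin> A\<close>] in \<open>auto intro!: continuous_intros simp: c\<close>)
      then show ?thesis by (simp add: a c)
    qed
  qed
  have move: "lar_state A s ((1 - a) * \<mu>) (\<tau> + a * l1_norm d) (b + a *\<^sub>R d)"
    if "0 \<le> a" "a \<le> \<alpha>" for a
    using that \<alpha> d le by (intro lar_state_move[OF st]) auto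
  have len: "l1_norm (b' - b) = \<alpha> * l1_norm d"
    using \<alpha> by (simp add: b' l1_norm_scaleR)
  show "\<forall>a\<in>{0..1}. \<exists>\<mu>'. lar_state A s \<mu>' (linepath \<tau> (\<tau> + l1_norm (b' - b)) a) (linepath b b' a)"
  proof
    fix a :: real assume a: "a \<in> {0..1}"
    have "linepath \<tau> (\<tau> + l1_norm (b' - b)) a = \<tau> + (a * \<alpha>) * l1_norm d"
      by (simp add: len linepath_def algebra_simps)
    moreover have "linepath b b' a = b + (a * \<alpha>) *\<^sub>R d"
      by (simp add: b' linepath_def algebra_simps)
    moreover have "a * \<alpha> \<le> \<alpha>" using a \<alpha> by (simp add: mult_left_le_one_le)
    ultimately show "\<exists>\<mu>'. lar_state A s \<mu>' (linepath \<tau> (\<tau> + l1_norm (b' - b)) a) (linepath b b' a)"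
      using move[of "a * \<alpha>"] a \<alpha> by auto
  qed
  \<comment> \<open>The choice of sign at a zero correlation is harmless: for a newly active
    predictor the common value is then zero.\<close>
  define s' where "s' j = (if j \<in> A then s j else if 0 \<le> resid_corr X y b' $ j then 1 else -1)" for j
  have end_st: "lar_state A s ((1 - \<alpha>) * \<mu>) (\<tau> + l1_norm (b' - b)) b'"
    unfolding len using move[of \<alpha>] \<alpha> by (simp add: b')
  have "resid_corr X y b' $ j = (1 - \<alpha>) * \<mu> * s' j" if "j \<in> A'" for j
  proof (cases "j \<in> A")
    case True
    then show ?thesis using end_st by (simp add: lar_state_def s'_def)
  next
    case False
    obtain i where "i \<in> A" using st by (auto simp: lar_state_def)
    then have "\<bar>resid_corr X y b' $ i\<bar> \<le> \<bar>resid_corr X y b' $ j\<bar>"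
      using that False A' by (auto simp: caught_up_def)
    moreover have "\<bar>resid_corr X y b' $ i\<bar> = (1 - \<alpha>) * \<mu>"
      using cA[OF \<open>i \<in> A\<close>, of \<alpha>] s[of i] \<alpha> st by (auto simp: abs_mult lar_state_def b')
    moreover have "\<bar>resid_corr X y b' $ j\<bar> \<le> (1 - \<alpha>) * \<mu>" using end_st by (simp add: lar_state_def)
    ultimately show ?thesis using False by (auto simp: s'_def)
  qed
  \<comment> \<open>The signs change only outside \<open>A\<close>, where \<open>b'\<close> still
    vanishes.\<close>
  moreover have "(\<Sum>j\<in>UNIV. s' j * b' $ j) = (\<Sum>j\<in>UNIV. s j * b' $ j)"
    using end_st by (intro sum.cong) (auto simp: s'_def lar_state_def)
  ultimately have "lar_state A' s' ((1 - \<alpha>) * \<mu>) (\<tau> + l1_norm (b' - b)) b'"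
    using end_st A' unfolding lar_state_def by (auto simp: s'_def)
  then show "\<exists>s' \<mu>'. lar_state A' s' \<mu>' (\<tau> + l1_norm (b' - b)) b'" by blast
qed

text \<open>The step ends at the least element of \<open>T\<close>, the times at which some inactive
  predictor has caught up. The alternative in the conclusion makes the construction of a run
  terminate.\<close>

lemma lar_step_exists:
  assumes st: "lar_state A s \<mu> \<tau> b"
  shows "\<exists>b' A'. lar_step X y b A b' A' \<and> (full_ls X y b' \<or> A \<subset> A')"
proof -
  define d where "d = inverse_on A (transpose (sub_columns A X) ** sub_columns A X) *v resid_corr X y b"
  note inv = inverse_on_gram_mult[OF inj_X, of _ A "resid_corr X y b", folded d_def]
  have r0: "resid_corr X (y - X *v b) d $ j = 0" if "j \<in> A" for j
    using inv(2)[OF that] by (simp add: resid_corr_def matrix_vector_mult_diff_distrib)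
  have min: "is_arg_min (rss X (y - X *v b)) (\<lambda>d. \<forall>j. j \<notin> A \<longrightarrow> d $ j = 0) d"
    unfolding normal_equations using inv(1) r0 by blast
  have s: "\<bar>s j\<bar> = 1" for j using st unfolding lar_state_def by (metis abs_1 abs_minus_cancel empty_iff insertE)
  have c: "resid_corr X y (b + a *\<^sub>R d) $ j = resid_corr X y b $ j - a * (transpose X *v (X *v d)) $ j" for a j
    by (simp add: resid_corr_add matrix_vector_mult_scaleR)
  have cA: "resid_corr X y (b + a *\<^sub>R d) $ j = (1 - a) * \<mu> * s j" if "j \<in> A" for a j
    using st inv(2)[OF that] that unfolding c by (auto simp: lar_state_def algebra_simps)
  define T where "T = {a \<in> {0..1}. caught_up A (resid_corr X y (b + a *\<^sub>R d)) \<noteq> {}}"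
  have T: "T = (\<Union>j\<in>- A. {0..1} \<inter>
      {a. (1 - a) * \<mu> \<le> \<bar>resid_corr X y b $ j - a * (transpose X *v (X *v d)) $ j\<bar>})"
  proof -
    have "caught_up A (resid_corr X y (b + a *\<^sub>R d)) \<noteq> {} \<longleftrightarrow>
        (\<exists>j\<in>- A. (1 - a) * \<mu> \<le> \<bar>resid_corr X y b $ j - a * (transpose X *v (X *v d)) $ j\<bar>)"
      if "a \<in> {0..1}" for a
    proof -
      have "\<bar>resid_corr X y (b + a *\<^sub>R d) $ i\<bar> = (1 - a) * \<mu>" if "i \<in> A" for i
        using cA[OF that, of a] s[of i] \<open>a \<in> {0..1}\<close> st by (simp add: abs_mult lar_state_def)
      moreover have "A \<noteq> {}" using st by (simp add: lar_state_def)
      ultimately show ?thesis by (auto simp: caught_up_def c)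
    qed
    then show ?thesis unfolding T_def by blast
  qed
  show ?thesis
  proof (cases "T = {}")
    case True
    have "A = UNIV"
    proof (rule ccontr)
      assume "A \<noteq> UNIV"
      then obtain j where "j \<in> - A" by blast
      \<comment> \<open>At time 1 the active correlations are zero, so every inactive predictor has
        caught up.\<close>
      then have "1 \<in> T" unfolding T by force
      with True show False by simp
    qed
    then have "full_ls X y (b + d)"
      using cA[of _ 1] by (simp add: full_ls_iff vec_eq_iff)
    moreover have "lar_step X y b A (b + 1 *\<^sub>R d) A"
      unfolding lar_step_def using min True \<open>A = UNIV\<close>
      by (intro exI[of _ d] exI[of _ 1]) (auto simp: caught_up_def)
    ultimately show ?thesis by auto
  next
    case False
    have "closed ({0..1} \<inter> {a. (1 - a) * \<mu> \<le> \<bar>resid_corr X y b $ j - a * (transpose X *v (X *v d)) $ j\<bar>})" for j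
      by (intro closed_Int closed_Collect_le continuous_intros)
    \<comment> \<open>A finite union of closed sets; being bounded as well, \<open>T\<close> attains
      its infimum.\<close>
    then have "closed T" unfolding T by (intro closed_UN) auto
    moreover have "bounded T" by (rule bounded_subset[of "{0..1}"]) (auto simp: T_def)
    ultimately obtain \<alpha> where \<alpha>: "\<alpha> \<in> T" "\<And>a. a \<in> T \<Longrightarrow> \<alpha> \<le> a"
      using compact_attains_inf[of T] False compact_eq_bounded_closed by blast
    let ?b = "b + \<alpha> *\<^sub>R d"
    have "lar_step X y b A ?b (A \<union> caught_up A (resid_corr X y ?b))"
      unfolding lar_step_def
    proof (intro exI[of _ d] exI[of _ \<alpha>] conjI allI impI)
      fix a' assume "0 \<le> a' \<and> a' < \<alpha>"
      then have "a' \<notin> T" using \<alpha>(2)[of a'] by auto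
      moreover have "a' \<in> {0..1}" using \<open>0 \<le> a' \<and> a' < \<alpha>\<close> \<alpha>(1) by (auto simp: T_def)
      ultimately show "caught_up A (resid_corr X y (b + a' *\<^sub>R d)) = {}" by (auto simp: T_def)
    qed (use min \<alpha> in \<open>auto simp: T_def\<close>)
    moreover have "A \<subset> A \<union> caught_up A (resid_corr X y ?b)"
      using \<alpha>(1) by (auto simp: T_def caught_up_def)
    ultimately show ?thesis by blast
  qed
qed

text \<open>A step that does not reach the full least squares solution enlarges \<open>A\<close>, so
  the number of inactive predictors decreases.\<close>

lemma lar_steps_exist:
  assumes "lar_state A s \<mu> \<tau> b"
  shows "\<exists>m p B. p 0 = b \<and> B 0 = A \<and>
    (\<forall>i<m. \<not> full_ls X y (p i) \<and> lar_step X y (p i) (B i) (p (Suc i)) (B (Suc i))) \<and>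
    full_ls X y (p m)"
  using assms
proof (induction "card (- A)" arbitrary: A s \<mu> \<tau> b rule: less_induct)
  case less
  show ?case
  proof (cases "full_ls X y b")
    case True
    then show ?thesis by (intro exI[of _ 0] exI[of _ "\<lambda>_. b"] exI[of _ "\<lambda>_. A"]) auto
  next
    case False
    obtain b' A' where step: "lar_step X y b A b' A'" and A': "full_ls X y b' \<or> A \<subset> A'"
      using lar_step_exists[OF less.prems] by blast
    have "\<exists>m p B. p 0 = b' \<and> B 0 = A' \<and>
      (\<forall>i<m. \<not> full_ls X y (p i) \<and> lar_step X y (p i) (B i) (p (Suc i)) (B (Suc i))) \<and>
      full_ls X y (p m)"
    proof (cases "full_ls X y b'")
      case True
      then show ?thesis by (intro exI[of _ 0] exI[of _ "\<lambda>_. b'"] exI[of _ "\<lambda>_. A'"]) auto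
    next
      case False
      then have "card (- A') < card (- A)" using A' by (intro psubset_card_mono) auto
      then show ?thesis using lar_step_state(2)[OF less.prems step] less.hyps by blast
    qed
    then obtain m p B where p: "p 0 = b'" "B 0 = A'" "full_ls X y (p m)"
      "\<And>i. i < m \<Longrightarrow> \<not> full_ls X y (p i) \<and> lar_step X y (p i) (B i) (p (Suc i)) (B (Suc i))"
      by blast
    show ?thesis
      by (rule exI[of _ "Suc m"], rule exI[of _ "case_nat b p"], rule exI[of _ "case_nat A B"])
         (use p step False in \<open>auto simp: less_Suc_eq_0_disj\<close>)
  qed
qed

lemma lar_state_initial:
  "\<exists>s. lar_state (max_abs_indices (resid_corr X y 0)) s (infnorm (resid_corr X y 0)) 0 0"
proof -
  define s where "s j = (if 0 \<le> resid_corr X y 0 $ j then 1 else -1 :: real)" for j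
  have "resid_corr X y 0 $ j = infnorm (resid_corr X y 0) * s j"
    if "j \<in> max_abs_indices (resid_corr X y 0)" for j
    using max_abs_indices_infnorm[OF that] by (auto simp: s_def)
  then show ?thesis
    by (intro exI[of _ s]) (auto simp: lar_state_def max_abs_indices_nonempty infnorm_pos_le
        component_le_infnorm_cart s_def l1_norm_def)
qed

lemma lar_run_exists: "\<exists>m p. lar_run X y m p"
proof -
  obtain s where "lar_state (max_abs_indices (resid_corr X y 0)) s (infnorm (resid_corr X y 0)) 0 0"
    using lar_state_initial by blast
  from lar_steps_exist[OF this] show ?thesis unfolding lar_run_def by metis
qed

lemma lar_run_states:
  assumes "lar_run X y m p"
  shows "\<exists>A. (\<forall>i\<le>m. \<exists>s \<mu>. lar_state (A i) s \<mu> (polygon_length p i) (p i)) \<and>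
    (\<forall>i<m. lar_step X y (p i) (A i) (p (Suc i)) (A (Suc i)))"
proof -
  obtain A where A: "p 0 = 0" "A 0 = max_abs_indices (resid_corr X y 0)"
    "\<And>i. i < m \<Longrightarrow> lar_step X y (p i) (A i) (p (Suc i)) (A (Suc i))"
    using assms unfolding lar_run_def by blast
  have "\<exists>s \<mu>. lar_state (A i) s \<mu> (polygon_length p i) (p i)" if "i \<le> m" for i
    using that
  proof (induction i)
    case 0
    then show ?case using lar_state_initial A by (auto simp: polygon_length_def)
  next
    case (Suc i)
    then obtain s \<mu> where "lar_state (A i) s \<mu> (polygon_length p i) (p i)" by auto
    then show ?case
      using lar_step_state(2)[OF _ A(3)[of i]] Suc.prems by (simp add: polygon_length_Suc)
  qed
  then show ?thesis using A by blast
qed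

text \<open>One set and one choice of signs serve the whole segment; the descent inequality compares
  two states with common signs.\<close>

lemma lar_run_segment:
  assumes "lar_run X y m p" "i < m"
  shows "\<exists>A s. \<forall>a\<in>{0..1}. \<exists>\<mu>. lar_state A s \<mu>
    (linepath (polygon_length p i) (polygon_length p (Suc i)) a) (linepath (p i) (p (Suc i)) a)"
proof -
  obtain A s \<mu> where "lar_state (A i) s \<mu> (polygon_length p i) (p i)"
    "lar_step X y (p i) (A i) (p (Suc i)) (A (Suc i))"
    using lar_run_states[OF assms(1)] assms(2) by (meson less_imp_le)
  from lar_step_state(1)[OF this] show ?thesis unfolding polygon_length_Suc by blast
qed

section \<open>Identification of the least angle path with the lasso path\<close>

lemma lar_run_strict_lasso_segment:
  assumes "lar_run X y m p" "i < m" "a \<in> {0..1}"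
  shows "strict_lasso (linepath (polygon_length p i) (polygon_length p (Suc i)) a)
    (linepath (p i) (p (Suc i)) a)"
  using lar_run_segment[OF assms(1,2)] assms(3) lar_state_strict_lasso by blast

text \<open>At the full least squares solution the correlations vanish, so the expansion of
  \<open>rss\<close> has no linear term.\<close>

lemma lar_run_strict_lasso_end:
  assumes "lar_run X y m p" "polygon_length p m \<le> \<tau>"
  shows "strict_lasso \<tau> (p m)"
  unfolding strict_lasso_def
proof (intro conjI allI impI)
  obtain A s \<mu> where "lar_state A s \<mu> (polygon_length p m) (p m)"
    using lar_run_states[OF assms(1)] by blast
  then show "l1_norm (p m) \<le> \<tau>" using assms(2) by (simp add: lar_state_def)
  fix b' :: "real ^ 'k"
  have "resid_corr X y (p m) = 0"
    using assms(1) by (auto simp: lar_run_def simp flip: full_ls_iff)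
  then show "rss X y (p m) + (norm (X *v (b' - p m)))\<^sup>2 \<le> rss X y b'"
    using rss_add[of X y "p m" "b' - p m"] by simp
qed

lemma strict_lasso_exists:
  assumes "0 \<le> \<tau>"
  shows "\<exists>b. strict_lasso \<tau> b"
proof -
  obtain m p where run: "lar_run X y m p" using lar_run_exists by blast
  show ?thesis
    using polygon_length_cover[OF assms, of p m]
  proof (elim disjE exE bexE conjE)
    assume "polygon_length p m \<le> \<tau>"
    then show ?thesis using lar_run_strict_lasso_end[OF run] by blast
  next
    fix i a
    assume "i < m" "a \<in> {0..1}" "\<tau> = linepath (polygon_length p i) (polygon_length p (Suc i)) a"
    then show ?thesis using lar_run_strict_lasso_segment[OF run, of i a] by auto
  qed
qed

text \<open>The common curve of the theorem: each of the three path predicates turns out to mean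
  agreement with it at nonnegative parameters.\<close>

definition solution :: "real \<Rightarrow> real ^ 'k" where
  "solution \<tau> = (SOME b. strict_lasso \<tau> b)"

lemma strict_lasso_solution: "0 \<le> \<tau> \<Longrightarrow> strict_lasso \<tau> (solution \<tau>)"
  unfolding solution_def using strict_lasso_exists by (rule someI_ex)

lemma solution_eq: "strict_lasso \<tau> b \<Longrightarrow> solution \<tau> = b"
  by (metis solution_def someI strict_lasso_unique)

lemma lasso_path_iff: "lasso_path X y q \<longleftrightarrow> (\<forall>\<tau>\<ge>0. q \<tau> = solution \<tau>)"
  by (auto simp: lasso_path_def strict_lasso_arg_min[OF strict_lasso_solution])

text \<open>Every run passes only through strict lasso minimizers for the bound equal to the length
  travelled, which determines the curve. For the converse one run suffices.\<close>

lemma lar_path_iff: "lar_path X y q \<longleftrightarrow> (\<forall>\<tau>\<ge>0. q \<tau> = solution \<tau>)"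
proof
  assume "lar_path X y q"
  then obtain m p where run: "lar_run X y m p" and q: "traverses_polygon q m p"
    by (auto simp: lar_path_def)
  show "\<forall>\<tau>\<ge>0. q \<tau> = solution \<tau>"
  proof (intro allI impI)
    fix \<tau> :: real assume "0 \<le> \<tau>"
    from polygon_length_cover[OF this, of p m] have "strict_lasso \<tau> (q \<tau>)"
      using lar_run_strict_lasso_segment[OF run] lar_run_strict_lasso_end[OF run] q
      by (auto simp: traverses_polygon_def)
    then show "q \<tau> = solution \<tau>" by (simp add: solution_eq)
  qed
next
  assume q: "\<forall>\<tau>\<ge>0. q \<tau> = solution \<tau>"
  obtain m p where run: "lar_run X y m p" using lar_run_exists by blast
  have "traverses_polygon q m p"
    unfolding traverses_polygon_def
  proof (intro conjI allI impI ballI)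
    fix i a assume i: "i < m" and a: "a \<in> {0..1 :: real}"
    have "0 \<le> linepath (polygon_length p i) (polygon_length p (Suc i)) a"
      using a by (simp add: linepath_def polygon_length_nonneg)
    then show "q (linepath (polygon_length p i) (polygon_length p (Suc i)) a) = linepath (p i) (p (Suc i)) a"
      using q solution_eq[OF lar_run_strict_lasso_segment[OF run i a]] by simp
  next
    fix \<tau> assume "polygon_length p m \<le> \<tau>"
    then show "q \<tau> = p m"
      using q solution_eq[OF lar_run_strict_lasso_end[OF run]] polygon_length_nonneg[of p m] by auto
  qed
  with run show "lar_path X y q" unfolding lar_path_def by blast
qed


text \<open>Evolution variational inequality for the residual, as a curve of steepest descent of the
  convex function \<open>z \<mapsto> infnorm (transpose X *v z)\<close>.\<close>

definition descends :: "real \<Rightarrow> real ^ 'k \<Rightarrow> real \<Rightarrow> real ^ 'k \<Rightarrow> bool" where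
  "descends \<tau>\<^sub>1 b\<^sub>1 \<tau>\<^sub>2 b\<^sub>2 \<longleftrightarrow> (\<forall>z. (norm (y - X *v b\<^sub>2 - z))\<^sup>2
     + 2 * (\<tau>\<^sub>2 - \<tau>\<^sub>1) * (infnorm (resid_corr X y b\<^sub>2) - infnorm (transpose X *v z))
     \<le> (norm (y - X *v b\<^sub>1 - z))\<^sup>2)"

text \<open>Take the residual at \<open>b\<^sub>1\<close> as test point \<open>z\<close>, which
  makes the right-hand side zero. If the parameters agree, this forces the residuals to
  agree.\<close>

lemma descends_infnorm_le:
  assumes "descends \<tau>\<^sub>1 b\<^sub>1 \<tau>\<^sub>2 b\<^sub>2" "\<tau>\<^sub>1 \<le> \<tau>\<^sub>2"
  shows "infnorm (resid_corr X y b\<^sub>2) \<le> infnorm (resid_corr X y b\<^sub>1)"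
proof (cases "\<tau>\<^sub>1 = \<tau>\<^sub>2")
  case True
  have "(norm (y - X *v b\<^sub>2 - (y - X *v b\<^sub>1)))\<^sup>2 \<le> 0"
    using assms(1) True unfolding descends_def by (metis (no_types, lifting) add.right_neutral
        diff_self mult_zero_left mult_zero_right norm_zero power_zero_numeral)
  then show ?thesis by (simp add: resid_corr_def)
next
  case False
  have "(norm (y - X *v b\<^sub>2 - (y - X *v b\<^sub>1)))\<^sup>2
     + 2 * (\<tau>\<^sub>2 - \<tau>\<^sub>1) * (infnorm (resid_corr X y b\<^sub>2) - infnorm (resid_corr X y b\<^sub>1))
     \<le> (norm (y - X *v b\<^sub>1 - (y - X *v b\<^sub>1)))\<^sup>2"
    using assms(1) unfolding descends_def resid_corr_def by blast
  then have "2 * (\<tau>\<^sub>2 - \<tau>\<^sub>1) * (infnorm (resid_corr X y b\<^sub>2) - infnorm (resid_corr X y b\<^sub>1)) \<le> 0"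
    using zero_le_power2[of "norm (y - X *v b\<^sub>2 - (y - X *v b\<^sub>1))"]
    unfolding diff_self norm_zero zero_power2 by linarith
  then show ?thesis using False assms(2) by (simp add: mult_le_0_iff)
qed

text \<open>Adding the inequalities gives the norm at \<open>b\<^sub>2\<close> the weight
  \<open>\<tau>\<^sub>2 - \<tau>\<^sub>1\<close>; by monotonicity it may be replaced by the norm at
  \<open>b\<^sub>3\<close>.\<close>

lemma descends_trans:
  assumes "descends \<tau>\<^sub>1 b\<^sub>1 \<tau>\<^sub>2 b\<^sub>2" "descends \<tau>\<^sub>2 b\<^sub>2 \<tau>\<^sub>3 b\<^sub>3" "\<tau>\<^sub>1 \<le> \<tau>\<^sub>2" "\<tau>\<^sub>2 \<le> \<tau>\<^sub>3"
  shows "descends \<tau>\<^sub>1 b\<^sub>1 \<tau>\<^sub>3 b\<^sub>3"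
  unfolding descends_def
proof
  fix z
  have "2 * (\<tau>\<^sub>2 - \<tau>\<^sub>1) * infnorm (resid_corr X y b\<^sub>3) \<le> 2 * (\<tau>\<^sub>2 - \<tau>\<^sub>1) * infnorm (resid_corr X y b\<^sub>2)"
    using descends_infnorm_le[OF assms(2,4)] assms(3) by (intro mult_left_mono) auto
  then show "(norm (y - X *v b\<^sub>3 - z))\<^sup>2
     + 2 * (\<tau>\<^sub>3 - \<tau>\<^sub>1) * (infnorm (resid_corr X y b\<^sub>3) - infnorm (transpose X *v z))
     \<le> (norm (y - X *v b\<^sub>1 - z))\<^sup>2"
    using assms(1)[unfolded descends_def, rule_format, of z]
      assms(2)[unfolded descends_def, rule_format, of z] by (simp add: algebra_simps)
qed

text \<open>An implicit Euler step: in the square expanded around \<open>b\<^sub>2\<close>, the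
  common signs evaluate the product of the correlations at \<open>b\<^sub>2\<close> with the
  increment exactly, and Hoelder bounds the one for \<open>z\<close>.\<close>

lemma lar_state_descends:
  assumes 1: "lar_state A s \<mu>\<^sub>1 \<tau>\<^sub>1 b\<^sub>1" and 2: "lar_state A s \<mu>\<^sub>2 \<tau>\<^sub>2 b\<^sub>2"
    and len: "l1_norm (b\<^sub>2 - b\<^sub>1) \<le> \<tau>\<^sub>2 - \<tau>\<^sub>1"
  shows "descends \<tau>\<^sub>1 b\<^sub>1 \<tau>\<^sub>2 b\<^sub>2"
  unfolding descends_def
proof
  fix z
  let ?d = "b\<^sub>2 - b\<^sub>1"
  have "(\<Sum>j\<in>UNIV. s j * ?d $ j) = \<tau>\<^sub>2 - \<tau>\<^sub>1"
    using 1 2 by (simp add: lar_state_def algebra_simps sum_subtractf)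
  moreover have "\<forall>j. j \<notin> A \<longrightarrow> ?d $ j = 0" using 1 2 by (simp add: lar_state_def)
  ultimately have inner: "resid_corr X y b\<^sub>2 \<bullet> ?d = infnorm (resid_corr X y b\<^sub>2) * (\<tau>\<^sub>2 - \<tau>\<^sub>1)"
    using lar_state_inner[OF 2, of ?d] lar_state_infnorm[OF 2] by simp
  have "(transpose X *v z) \<bullet> ?d \<le> infnorm (transpose X *v z) * l1_norm ?d"
    by (rule inner_le_infnorm_l1)
  also have "\<dots> \<le> infnorm (transpose X *v z) * (\<tau>\<^sub>2 - \<tau>\<^sub>1)"
    using len infnorm_pos_le by (intro mult_left_mono)
  finally have z: "z \<bullet> (X *v ?d) \<le> infnorm (transpose X *v z) * (\<tau>\<^sub>2 - \<tau>\<^sub>1)"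
    by (simp add: transpose_mult_inner)
  have r: "y - X *v b\<^sub>1 - z = (y - X *v b\<^sub>2 - z) + X *v ?d"
    by (simp add: matrix_vector_mult_diff_distrib)
  have "(norm (y - X *v b\<^sub>1 - z))\<^sup>2
      = (norm (y - X *v b\<^sub>2 - z))\<^sup>2 + 2 * ((y - X *v b\<^sub>2 - z) \<bullet> (X *v ?d)) + (norm (X *v ?d))\<^sup>2"
    unfolding r by (rule power2_norm_add)
  also have "(y - X *v b\<^sub>2 - z) \<bullet> (X *v ?d)
      = infnorm (resid_corr X y b\<^sub>2) * (\<tau>\<^sub>2 - \<tau>\<^sub>1) - z \<bullet> (X *v ?d)"
    using inner by (simp only: inner_diff_left[of "y - X *v b\<^sub>2"] resid_corr_def transpose_mult_inner)
  finally have "(norm (y - X *v b\<^sub>1 - z))\<^sup>2 = (norm (y - X *v b\<^sub>2 - z))\<^sup>2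
      + 2 * (infnorm (resid_corr X y b\<^sub>2) * (\<tau>\<^sub>2 - \<tau>\<^sub>1) - z \<bullet> (X *v ?d)) + (norm (X *v ?d))\<^sup>2" .
  moreover have "2 * (\<tau>\<^sub>2 - \<tau>\<^sub>1) * (infnorm (resid_corr X y b\<^sub>2) - infnorm (transpose X *v z))
      = 2 * (infnorm (resid_corr X y b\<^sub>2) * (\<tau>\<^sub>2 - \<tau>\<^sub>1)) - 2 * (infnorm (transpose X *v z) * (\<tau>\<^sub>2 - \<tau>\<^sub>1))"
    by (simp only: algebra_simps)
  ultimately show "(norm (y - X *v b\<^sub>2 - z))\<^sup>2
     + 2 * (\<tau>\<^sub>2 - \<tau>\<^sub>1) * (infnorm (resid_corr X y b\<^sub>2) - infnorm (transpose X *v z))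
     \<le> (norm (y - X *v b\<^sub>1 - z))\<^sup>2"
    using z zero_le_power2[of "norm (X *v ?d)"] by (smt (verit))
qed

lemma solution_descends_segment:
  assumes run: "lar_run X y m p" and "i < m"
    and "polygon_length p i \<le> \<sigma>" "\<sigma> \<le> \<tau>" "\<tau> \<le> polygon_length p (Suc i)"
  shows "descends \<sigma> (solution \<sigma>) \<tau> (solution \<tau>)"
proof -
  define L where "L = linepath (polygon_length p i) (polygon_length p (Suc i))"
  have "\<sigma> \<in> L ` {0..1}" "\<tau> \<in> L ` {0..1}"
    using assms by (auto simp: L_def linepath_image_01 closed_segment_eq_real_ivl)
  then obtain a c where a: "a \<in> {0..1}" "\<sigma> = L a" and c: "c \<in> {0..1}" "\<tau> = L c" by blast
  obtain A s where st: "\<And>a. a \<in> {0..1} \<Longrightarrow> \<exists>\<mu>. lar_state A s \<mu> (L a) (linepath (p i) (p (Suc i)) a)"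
    using lar_run_segment[OF run \<open>i < m\<close>] unfolding L_def by blast
  have sol: "solution (L a) = linepath (p i) (p (Suc i)) a" if "a \<in> {0..1}" for a
    using lar_run_strict_lasso_segment[OF run \<open>i < m\<close> that] by (simp add: L_def solution_eq)
  have diff: "L c - L a = (c - a) * l1_norm (p (Suc i) - p i)"
    by (simp add: L_def linepath_def polygon_length_Suc algebra_simps)
  have pdiff: "solution \<tau> - solution \<sigma> = (c - a) *\<^sub>R (p (Suc i) - p i)"
    using a c by (simp add: sol linepath_def algebra_simps)
  \<comment> \<open>The absolute value avoids ordering \<open>a\<close> and \<open>c\<close>, which
    \<open>\<sigma> \<le> \<tau>\<close> does not determine on a segment of length 0.\<close>
  have "l1_norm (solution \<tau> - solution \<sigma>) = \<bar>\<tau> - \<sigma>\<bar>"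
    unfolding pdiff l1_norm_scaleR using a c
    by (simp add: diff abs_mult l1_norm_nonneg)
  then have "l1_norm (solution \<tau> - solution \<sigma>) \<le> \<tau> - \<sigma>" using assms by simp
  moreover obtain \<mu>\<^sub>1 \<mu>\<^sub>2 where "lar_state A s \<mu>\<^sub>1 \<sigma> (solution \<sigma>)" "lar_state A s \<mu>\<^sub>2 \<tau> (solution \<tau>)"
    using st[OF a(1)] st[OF c(1)] a c sol by auto
  ultimately show ?thesis by (intro lar_state_descends)
qed

text \<open>The segments are glued at the breakpoints by transitivity; beyond the last one the curve
  is constant with zero correlations.\<close>

lemma solution_descends:
  assumes "0 \<le> \<sigma>" "\<sigma> \<le> \<tau>"
  shows "descends \<sigma> (solution \<sigma>) \<tau> (solution \<tau>)"
proof -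
  obtain m p where run: "lar_run X y m p" using lar_run_exists by blast
  have inside: "descends \<sigma> (solution \<sigma>) \<tau> (solution \<tau>)"
    if "i \<le> m" "0 \<le> \<sigma>" "\<sigma> \<le> \<tau>" "\<tau> \<le> polygon_length p i" for i \<sigma> \<tau>
    using that
  proof (induction i arbitrary: \<sigma> \<tau>)
    case 0
    then have "\<sigma> = 0" "\<tau> = 0" by (auto simp: polygon_length_def)
    then show ?case by (simp add: descends_def)
  next
    case (Suc i)
    let ?L = "polygon_length p i"
    note seg = solution_descends_segment[OF run Suc_le_lessD[OF Suc.prems(1)]]
    consider "\<tau> \<le> ?L" | "?L \<le> \<sigma>" | "\<sigma> \<le> ?L" "?L \<le> \<tau>" by linarith
    then show ?case
    proof cases
      case 1
      then show ?thesis using Suc by auto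
    next
      case 2
      then show ?thesis using Suc.prems by (intro seg)
    next
      case 3
      have "descends \<sigma> (solution \<sigma>) ?L (solution ?L)" using Suc 3 by auto
      moreover have "descends ?L (solution ?L) \<tau> (solution \<tau>)" using Suc.prems 3 by (intro seg) auto
      ultimately show ?thesis using 3 by (rule descends_trans)
    qed
  qed
  let ?L = "polygon_length p m"
  have outside: "descends \<sigma> (solution \<sigma>) \<tau> (solution \<tau>)" if "?L \<le> \<sigma>" "\<sigma> \<le> \<tau>" for \<sigma> \<tau>
  proof -
    have "solution \<sigma> = p m" "solution \<tau> = p m"
      using solution_eq[OF lar_run_strict_lasso_end[OF run]] that by auto
    moreover have "full_ls X y (p m)" using run by (auto simp: lar_run_def)
    ultimately show ?thesis
      using that by (auto simp: descends_def full_ls_iff infnorm_0 infnorm_pos_le mult_nonneg_nonpos)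
  qed
  consider "\<tau> \<le> ?L" | "?L \<le> \<sigma>" | "\<sigma> \<le> ?L" "?L \<le> \<tau>" by linarith
  then show ?thesis
  proof cases
    case 1
    then show ?thesis using inside[of m] assms by simp
  next
    case 2
    then show ?thesis using outside assms by simp
  next
    case 3
    have "descends \<sigma> (solution \<sigma>) ?L (solution ?L)" using inside[of m] 3 assms by simp
    moreover have "descends ?L (solution ?L) \<tau> (solution \<tau>)" using outside 3 by simp
    ultimately show ?thesis using 3 by (rule descends_trans)
  qed
qed


section \<open>Convergence of forward stagewise regression\<close>

text \<open>The stagewise residual is an explicit Euler scheme for the descent curve of the residual, and
  the terms of first order in \<open>\<epsilon>\<close> cancel against the variational inequality.\<close>

lemma stagewise_error:
  assumes run: "stagewise_run X y \<epsilon> b" and "0 < \<epsilon>"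
  shows "(norm (X *v (b n - solution (n * \<epsilon>))))\<^sup>2 \<le> n * \<epsilon>\<^sup>2"
proof (induction n)
  case 0
  have "l1_norm (solution 0) \<le> 0" using strict_lasso_solution[of 0] by (simp add: strict_lasso_def)
  then have "solution 0 = 0" by (rule l1_norm_le_0D)
  then show ?case using run by (simp add: stagewise_run_def)
next
  case (Suc n)
  obtain j where j: "j \<in> max_abs_indices (resid_corr X y (b n))"
    and b: "b (Suc n) = b n + axis j (\<epsilon> * sgn (resid_corr X y (b n) $ j))"
    using run unfolding stagewise_run_def by blast
  define \<sigma> where "\<sigma> = sgn (resid_corr X y (b n) $ j)"
  define r where "r = y - X *v b n"
  define w where "w = y - X *v solution (Suc n * \<epsilon>)"
  define x where "x = column j X"
  have x: "norm x = 1" by (simp add: x_def norm_column)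
  \<comment> \<open>\<open>\<sigma>\<close> is 0 once all correlations vanish, so in general only
    upper bounds hold.\<close>
  have \<sigma>: "\<sigma>\<^sup>2 \<le> 1" "\<bar>\<sigma>\<bar> \<le> 1" by (auto simp: \<sigma>_def sgn_if)
  have r': "y - X *v b (Suc n) = r - (\<epsilon> * \<sigma>) *\<^sub>R x"
    by (simp add: b r_def \<sigma>_def x_def matrix_vector_right_distrib mult_axis)
  have xr: "\<sigma> * (x \<bullet> r) = infnorm (resid_corr X y (b n))"
    using max_abs_indices_infnorm[OF j]
    by (simp add: \<sigma>_def x_def r_def resid_corr_def transpose_mult_nth sgn_mult_self_eq abs_sgn mult.commute)
  have "\<sigma> * (x \<bullet> w) \<le> \<bar>\<sigma>\<bar> * \<bar>x \<bullet> w\<bar>" by (metis abs_ge_self abs_mult)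
  also have "\<dots> \<le> \<bar>x \<bullet> w\<bar>" using \<sigma>(2) by (simp add: mult_left_le_one_le)
  also have "\<dots> \<le> infnorm (resid_corr X y (solution (Suc n * \<epsilon>)))"
    using component_le_infnorm_cart[of "transpose X *v w" j]
    by (simp add: transpose_mult_nth x_def w_def resid_corr_def)
  finally have xw: "\<sigma> * (x \<bullet> w) \<le> infnorm (resid_corr X y (solution (Suc n * \<epsilon>)))" .
  have "descends (n * \<epsilon>) (solution (n * \<epsilon>)) (Suc n * \<epsilon>) (solution (Suc n * \<epsilon>))"
    using \<open>0 < \<epsilon>\<close> by (intro solution_descends) (auto simp: algebra_simps)
  \<comment> \<open>The test point is the stagewise residual, so the norm that the chosen predictor
    attains in \<open>xr\<close> appears.\<close>
  from this[unfolded descends_def, rule_format, of r]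
  have "(norm (w - r))\<^sup>2 + 2 * \<epsilon> * (infnorm (resid_corr X y (solution (Suc n * \<epsilon>)))
        - infnorm (resid_corr X y (b n))) \<le> (norm (y - X *v solution (n * \<epsilon>) - r))\<^sup>2"
    by (simp add: w_def r_def resid_corr_def algebra_simps)
  moreover have "y - X *v solution (n * \<epsilon>) - r = X *v (b n - solution (n * \<epsilon>))"
    by (simp add: r_def matrix_vector_mult_diff_distrib)
  ultimately have desc: "(norm (w - r))\<^sup>2 + 2 * \<epsilon> * (infnorm (resid_corr X y (solution (Suc n * \<epsilon>)))
        - infnorm (resid_corr X y (b n))) \<le> n * \<epsilon>\<^sup>2"
    using Suc.IH by simp
  have "X *v (b (Suc n) - solution (Suc n * \<epsilon>)) = w - (y - X *v b (Suc n))"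
    by (simp add: w_def matrix_vector_mult_diff_distrib)
  also have "\<dots> = (w - r) + (\<epsilon> * \<sigma>) *\<^sub>R x" by (simp add: r')
  finally have eq: "X *v (b (Suc n) - solution (Suc n * \<epsilon>)) = (w - r) + (\<epsilon> * \<sigma>) *\<^sub>R x" .
  have sq: "(norm (u + c *\<^sub>R x))\<^sup>2 = (norm u)\<^sup>2 + 2 * c * (x \<bullet> u) + c\<^sup>2" for u c
    using x by (simp add: power2_norm_add inner_commute power_mult_distrib)
  \<comment> \<open>By \<open>xr\<close> and \<open>xw\<close> the cross term is at most the
    difference of norms controlled by \<open>desc\<close>, so one step adds only
    \<open>\<epsilon>\<^sup>2\<close>.\<close>
  have "(norm (X *v (b (Suc n) - solution (Suc n * \<epsilon>))))\<^sup>2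
      = (norm (w - r))\<^sup>2 + 2 * \<epsilon> * (\<sigma> * (x \<bullet> w) - \<sigma> * (x \<bullet> r)) + (\<epsilon> * \<sigma>)\<^sup>2"
    unfolding eq sq inner_diff_right by (simp add: right_diff_distrib)
  also have "\<dots> \<le> (norm (w - r))\<^sup>2 + 2 * \<epsilon> * (infnorm (resid_corr X y (solution (Suc n * \<epsilon>)))
        - infnorm (resid_corr X y (b n))) + \<epsilon>\<^sup>2"
  proof (intro add_mono mult_left_mono order.refl)
    show "(\<epsilon> * \<sigma>)\<^sup>2 \<le> \<epsilon>\<^sup>2" using \<sigma>(1) by (simp add: power_mult_distrib mult_left_le)
  qed (use xr xw \<open>0 < \<epsilon>\<close> in auto)
  also have "\<dots> \<le> n * \<epsilon>\<^sup>2 + \<epsilon>\<^sup>2" using desc by simp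
  finally show ?case by (simp add: algebra_simps)
qed

lemma infnorm_resid_corr_solution_le:
  assumes "0 \<le> \<tau>"
  shows "infnorm (resid_corr X y (solution \<tau>)) \<le> norm y"
proof -
  obtain j where j: "j \<in> max_abs_indices (resid_corr X y (solution \<tau>))"
    using max_abs_indices_nonempty by blast
  have "infnorm (resid_corr X y (solution \<tau>)) = \<bar>column j X \<bullet> (y - X *v solution \<tau>)\<bar>"
    using max_abs_indices_infnorm[OF j] by (simp add: resid_corr_def transpose_mult_nth)
  also have "\<dots> \<le> norm (y - X *v solution \<tau>)"
    using Cauchy_Schwarz_ineq2[of "column j X"] by (simp add: norm_column)
  also have "\<dots> \<le> norm y"
  proof (rule power2_le_imp_le)
    have "rss X y (solution \<tau>) \<le> rss X y 0"
      using strict_lasso_arg_min[OF strict_lasso_solution[OF assms], of "solution \<tau>"] assms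
      by (simp add: is_arg_min_linorder l1_norm_def)
    then show "(norm (y - X *v solution \<tau>))\<^sup>2 \<le> (norm y)\<^sup>2" by (simp add: rss_def)
  qed simp
  finally show ?thesis .
qed

text \<open>Compare at the grid time \<open>n * \<epsilon>\<close> first. The curve then moves for a
  time of at most \<open>\<epsilon>\<close>, and testing the descent inequality with its residual at
  the grid time bounds this displacement.\<close>

lemma stagewise_dist:
  assumes run: "stagewise_run X y \<epsilon> b" and "0 < \<epsilon>" "0 \<le> \<tau>"
  shows "norm (X *v (b (nat \<lfloor>\<tau> / \<epsilon>\<rfloor>) - solution \<tau>)) \<le> sqrt (\<tau> * \<epsilon>) + sqrt (2 * \<epsilon> * norm y)"
proof -
  define n where "n = nat \<lfloor>\<tau> / \<epsilon>\<rfloor>"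
  have "real n \<le> \<tau> / \<epsilon>" "\<tau> / \<epsilon> < real n + 1"
    using \<open>0 < \<epsilon>\<close> \<open>0 \<le> \<tau>\<close> unfolding n_def by (auto simp: of_nat_nat floor_correct)
  then have n: "n * \<epsilon> \<le> \<tau>" "\<tau> - n * \<epsilon> \<le> \<epsilon>"
    using \<open>0 < \<epsilon>\<close> by (auto simp: field_simps)
  have n0: "0 \<le> n * \<epsilon>" using \<open>0 < \<epsilon>\<close> by simp
  have "(norm (X *v (b n - solution (n * \<epsilon>))))\<^sup>2 \<le> n * \<epsilon>\<^sup>2"
    by (rule stagewise_error[OF run \<open>0 < \<epsilon>\<close>])
  also have "\<dots> \<le> \<tau> * \<epsilon>"
    using n \<open>0 < \<epsilon>\<close> by (simp add: power2_eq_square)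
  finally have 1: "norm (X *v (b n - solution (n * \<epsilon>))) \<le> sqrt (\<tau> * \<epsilon>)"
    by (rule real_le_rsqrt)
  define z where "z = y - X *v solution (n * \<epsilon>)"
  have "(norm (y - X *v solution \<tau> - z))\<^sup>2
      \<le> 2 * (\<tau> - n * \<epsilon>) * (infnorm (transpose X *v z) - infnorm (resid_corr X y (solution \<tau>)))"
    using solution_descends[OF n0 n(1), unfolded descends_def, rule_format, of z]
    by (simp add: z_def algebra_simps)
  also have "\<dots> \<le> 2 * (\<tau> - n * \<epsilon>) * norm y"
    using n infnorm_pos_le[of "resid_corr X y (solution \<tau>)"] infnorm_resid_corr_solution_le[OF n0]
    by (intro mult_left_mono) (auto simp: z_def resid_corr_def[symmetric])
  also have "\<dots> \<le> 2 * \<epsilon> * norm y"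
    using n by (intro mult_right_mono) auto
  finally have 2: "norm (y - X *v solution \<tau> - z) \<le> sqrt (2 * \<epsilon> * norm y)"
    by (rule real_le_rsqrt)
  have "X *v (b n - solution \<tau>) = X *v (b n - solution (n * \<epsilon>)) + (y - X *v solution \<tau> - z)"
    by (simp add: z_def matrix_vector_mult_diff_distrib)
  then show ?thesis
    unfolding n_def[symmetric] using norm_triangle_mono[OF 1 2] by simp
qed

text \<open>Guards against vacuity: \<open>fs0_path\<close> quantifies over all families of runs, so
  one family must exist before the limit can determine the path.\<close>

lemma stagewise_run_exists: "\<exists>b. stagewise_run X y \<epsilon> b"
proof -
  define J where "J v = (SOME j. j \<in> max_abs_indices (resid_corr X y v))" for v
  have J: "J v \<in> max_abs_indices (resid_corr X y v)" for v
    unfolding J_def using max_abs_indices_nonempty by (metis all_not_in_conv someI_ex)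
  define b where "b = rec_nat 0 (\<lambda>_ v. v + axis (J v) (\<epsilon> * sgn (resid_corr X y v $ J v)))"
  have "stagewise_run X y \<epsilon> b"
    using J by (auto simp: stagewise_run_def b_def)
  then show ?thesis by blast
qed

lemma stagewise_uniform_limit:
  assumes run: "\<forall>\<epsilon>>0. stagewise_run X y \<epsilon> (b \<epsilon>)"
  shows "uniform_limit {0..T} (\<lambda>\<epsilon> \<tau>. b \<epsilon> (nat \<lfloor>\<tau> / \<epsilon>\<rfloor>)) solution (at_right 0)"
proof (rule uniform_limitI)
  fix e :: real assume "0 < e"
  \<comment> \<open>An injective linear map is bounded below, which transfers the estimate from
    fitted values to coefficients.\<close>
  obtain B where B: "0 < B" "\<And>v. B * norm v \<le> norm (X *v v)"
    using linear_inj_bounded_below_pos[OF matrix_vector_mul_linear inj_X] by blast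
  have "((\<lambda>\<epsilon>. sqrt (T * \<epsilon>) + sqrt (2 * \<epsilon> * norm y)) \<longlongrightarrow> sqrt (T * 0) + sqrt (2 * 0 * norm y)) (at_right 0)"
    by (intro tendsto_intros)
  then have "eventually (\<lambda>\<epsilon>. sqrt (T * \<epsilon>) + sqrt (2 * \<epsilon> * norm y) < B * e) (at_right 0)"
    using \<open>0 < e\<close> \<open>0 < B\<close> by (intro order_tendstoD(2)) auto
  moreover have "eventually (\<lambda>\<epsilon>. \<epsilon> > 0) (at_right (0 :: real))"
    by (rule eventually_at_right_less)
  ultimately show "\<forall>\<^sub>F \<epsilon> in at_right 0. \<forall>\<tau>\<in>{0..T}. dist (b \<epsilon> (nat \<lfloor>\<tau> / \<epsilon>\<rfloor>)) (solution \<tau>) < e"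
  proof eventually_elim
    case (elim \<epsilon>)
    show ?case
    proof
      fix \<tau> assume \<tau>: "\<tau> \<in> {0..T}"
      let ?v = "b \<epsilon> (nat \<lfloor>\<tau> / \<epsilon>\<rfloor>) - solution \<tau>"
      have "B * norm ?v \<le> norm (X *v ?v)" by (rule B)
      also have "\<dots> \<le> sqrt (\<tau> * \<epsilon>) + sqrt (2 * \<epsilon> * norm y)"
        using run elim \<tau> by (intro stagewise_dist) auto
      also have "\<dots> \<le> sqrt (T * \<epsilon>) + sqrt (2 * \<epsilon> * norm y)"
        using elim \<tau> by (simp add: mult_right_mono)
      also have "\<dots> < B * e" by (rule elim)
      finally show "dist (b \<epsilon> (nat \<lfloor>\<tau> / \<epsilon>\<rfloor>)) (solution \<tau>) < e"
        using \<open>0 < B\<close> by (simp add: dist_norm)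
    qed
  qed
qed

lemma fs0_path_iff: "fs0_path X y q \<longleftrightarrow> (\<forall>\<tau>\<ge>0. q \<tau> = solution \<tau>)"
proof
  assume q: "fs0_path X y q"
  define b where "b \<epsilon> = (SOME b. stagewise_run X y \<epsilon> b)" for \<epsilon>
  have run: "\<forall>\<epsilon>>0. stagewise_run X y \<epsilon> (b \<epsilon>)"
    unfolding b_def using someI_ex[OF stagewise_run_exists] by blast
  show "\<forall>\<tau>\<ge>0. q \<tau> = solution \<tau>"
  proof (intro allI impI)
    fix \<tau> :: real assume "0 \<le> \<tau>"
    then have "uniform_limit {0..\<tau>} (\<lambda>\<epsilon> \<tau>. b \<epsilon> (nat \<lfloor>\<tau> / \<epsilon>\<rfloor>)) q (at_right 0)"
      using q run unfolding fs0_path_def by blast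
    from tendsto_uniform_limitI[OF this, of \<tau>]
    have "((\<lambda>\<epsilon>. b \<epsilon> (nat \<lfloor>\<tau> / \<epsilon>\<rfloor>)) \<longlongrightarrow> q \<tau>) (at_right 0)"
      using \<open>0 \<le> \<tau>\<close> by simp
    moreover have "((\<lambda>\<epsilon>. b \<epsilon> (nat \<lfloor>\<tau> / \<epsilon>\<rfloor>)) \<longlongrightarrow> solution \<tau>) (at_right 0)"
      using tendsto_uniform_limitI[OF stagewise_uniform_limit[OF run, of \<tau>], of \<tau>] \<open>0 \<le> \<tau>\<close> by simp
    ultimately show "q \<tau> = solution \<tau>"
      by (rule tendsto_unique[OF trivial_limit_at_right_real])
  qed
next
  assume q: "\<forall>\<tau>\<ge>0. q \<tau> = solution \<tau>"
  show "fs0_path X y q"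
    unfolding fs0_path_def
  proof (intro allI impI)
    fix b and T :: real
    assume "\<forall>\<epsilon>>0. stagewise_run X y \<epsilon> (b \<epsilon>)"
    from stagewise_uniform_limit[OF this, of T]
    show "uniform_limit {0..T} (\<lambda>\<epsilon> \<tau>. b \<epsilon> (nat \<lfloor>\<tau> / \<epsilon>\<rfloor>)) q (at_right 0)"
      by (rule uniform_limit_cong'[THEN iffD1, rotated 2]) (use q in auto)
  qed
qed

end


section \<open>The piecewise constant basis\<close>

theorem theorem3:
  fixes x :: "real ^ 'n" and t :: "real ^ 'k" and X :: "real ^ 'k ^ 'n"
  assumes X_def: "X = step_basis x t"
    and well_defined: "\<And>j. center (step_fun x (t $ j)) \<noteq> 0"
    and distinct_columns: "inj (\<lambda>j. column j X)"
    and independent_columns: "independent (columns X)"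
  shows "(\<forall>(A :: 'k set) s. A \<noteq> {} \<longrightarrow> (\<forall>j\<in>A. s j \<in> {-1, 1}) \<longrightarrow>
           (\<forall>j\<in>A. 0 \<le> ((diag_on A s
               ** inverse_on A (transpose (sub_columns A X) ** sub_columns A X)
               ** diag_on A s) *v vec 1) $ j))
       \<and> (\<forall>y :: real ^ 'n. (\<Sum>i\<in>UNIV. y $ i) = 0 \<longrightarrow>
           (\<exists>\<gamma>. (\<forall>p. lasso_path X y p \<longleftrightarrow> (\<forall>s\<ge>0. p s = \<gamma> s))
              \<and> (\<forall>p. fs0_path X y p \<longleftrightarrow> (\<forall>s\<ge>0. p s = \<gamma> s))
              \<and> (\<forall>p. lar_path X y p \<longleftrightarrow> (\<forall>s\<ge>0. p s = \<gamma> s))))"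
proof -
  obtain u where u: "\<And>j. 0 < u j"
    and gram: "\<And>i j. column i X \<bullet> column j X = ratio_kernel u i j"
    using step_basis_gram[OF well_defined] X_def by metis
  have norm: "norm (column j X) = 1" for j
    using gram[of j j] u[of j] by (simp add: norm_eq_1 ratio_kernel_def)
  have "inj u"
  proof (rule injI)
    fix i j assume "u i = u j"
    \<comment> \<open>Two unit vectors with inner product 1 are equal, so equal \<open>u\<close>
      would mean equal columns.\<close>
    then have "column i X \<bullet> column j X = 1"
      using u[of j] by (simp add: gram ratio_kernel_def)
    then have "(norm (column i X - column j X))\<^sup>2 = 0"
      using norm[of i] norm[of j] by (simp add: power2_norm_eq_inner norm_eq_1 inner_diff_left
          inner_diff_right inner_commute)
    then show "i = j" using injD[OF distinct_columns] by simp
  qed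
  \<comment> \<open>\<open>columns X\<close> is a set, so independence gives full rank only once the
    columns are known to be distinct.\<close>
  have "card (columns X) = CARD('k)"
    using card_image[OF distinct_columns] by (simp add: columns_def full_SetCompr_eq)
  then have "rank X = CARD('k)"
    using dim_eq_card_independent[OF independent_columns] by (simp add: column_rank_def)
  then have inj: "inj ((*v) X)" by (simp add: full_rank_injective)
  have cone: "0 \<le> s j * d $ j"
    if "0 \<le> \<mu>" "\<forall>j\<in>A. s j \<in> {-1, 1}" "\<forall>j. j \<notin> A \<longrightarrow> d $ j = 0"
      "\<forall>j\<in>A. (transpose X *v (X *v d)) $ j = \<mu> * s j" "j \<in> A" for A s \<mu> d j
  proof (rule ratio_kernel_cone[where A = A and \<mu> = \<mu> and u = u])
    fix i assume "i \<in> A"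
    have "X *v d = (\<Sum>l\<in>UNIV. d $ l *\<^sub>R column l X)"
      by (simp add: vec_eq_iff matrix_vector_mult_def column_def mult.commute)
    then have "(transpose X *v (X *v d)) $ i = (\<Sum>l\<in>UNIV. ratio_kernel u i l * d $ l)"
      by (simp add: transpose_mult_nth inner_sum_right gram mult.commute)
    also have "\<dots> = (\<Sum>l\<in>A. ratio_kernel u i l * d $ l)"
      using that(3) by (intro sum.mono_neutral_right) auto
    finally show "(\<Sum>l\<in>A. ratio_kernel u i l * d $ l) = \<mu> * s i"
      using that(4) \<open>i \<in> A\<close> by simp
  qed (use that u \<open>inj u\<close> in \<open>auto intro: inj_on_subset\<close>)
  show ?thesis
  proof (intro conjI allI impI ballI)
    fix A :: "'k set" and s :: "'k \<Rightarrow> real" and j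
    assume s: "\<forall>j\<in>A. s j \<in> {-1, 1}" and j: "j \<in> A"
    define v where "v = inverse_on A (transpose (sub_columns A X) ** sub_columns A X)
      *v (diag_on A s *v vec 1)"
    note v = inverse_on_gram_mult[OF inj, of _ A "diag_on A s *v vec 1", folded v_def]
    \<comment> \<open>\<open>v\<close> solves the system with right-hand side \<open>s\<close> on
      \<open>A\<close>, so the cone condition applies with \<open>\<mu> = 1\<close>; the outer
      diagonal factor supplies the remaining \<open>s j\<close>.\<close>
    have "0 \<le> s j * v $ j"
      using s v j by (intro cone[of 1 A s]) (auto simp: diag_on_mult_nth)
    then show "0 \<le> ((diag_on A s ** inverse_on A (transpose (sub_columns A X) ** sub_columns A X)
        ** diag_on A s) *v vec 1) $ j"
      using j by (simp add: v_def matrix_vector_mul_assoc[symmetric] diag_on_mult_nth)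
  next
    fix y :: "real ^ 'n"
    interpret cone_regression X y
      using inj norm cone by unfold_locales auto
    show "\<exists>\<gamma>. (\<forall>p. lasso_path X y p \<longleftrightarrow> (\<forall>s\<ge>0. p s = \<gamma> s))
        \<and> (\<forall>p. fs0_path X y p \<longleftrightarrow> (\<forall>s\<ge>0. p s = \<gamma> s))
        \<and> (\<forall>p. lar_path X y p \<longleftrightarrow> (\<forall>s\<ge>0. p s = \<gamma> s))"
      using lasso_path_iff fs0_path_iff lar_path_iff by blast
  qed
qed

end
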